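(* Let $m,n\ge1$ and let $A\in\mathbb R^{m\times n}$ satisfy $\sum_{i=1}^m A_{ij}^2\le1$ for every $j\in\{1,\dots,n\}$. Then $$\operatorname{disc}(A)\le 2395\left(1+\log_+\frac n9\right)^{1/4}+2\sqrt2 .$$
   Context: For a real matrix $A\in\mathbb R^{m\times n}$, $\operatorname{disc}(A)=\min_{\sigma\in\{-1,1\}^n}\|A\sigma\|_\infty$. Here $\log$ is the natural logarithm and $\log_+u=\max\{0,\log u\}$ for $u>0$. *)

theory Defs
  imports "HOL-Analysis.Analysis"
begin

definition sign_vectors :: "(real ^ 'n) set" where
  "sign_vectors = {\<sigma>. \<forall>j. \<sigma> $ j \<in> {-1, 1}}"

(* infnorm is the maximum norm with respect to the standard basis (infnorm_cart).
   The lemmas below show that the Min ranges over a finite nonempty set. *)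
definition disc :: "real ^ 'n ^ 'm \<Rightarrow> real" where
  "disc A = Min ((\<lambda>\<sigma>. infnorm (A *v \<sigma>)) ` sign_vectors)"

definition log_plus :: "real \<Rightarrow> real" where
  "log_plus u = max 0 (ln u)"

lemma finite_sign_vectors: "finite (sign_vectors :: (real ^ 'n) set)"
proof -
  have "(sign_vectors :: (real ^ 'n) set) \<subseteq> vec_lambda ` (UNIV \<rightarrow>\<^sub>E {-1, 1})"
  proof
    fix \<sigma> :: "real ^ 'n"
    assume "\<sigma> \<in> sign_vectors"
    then have "vec_nth \<sigma> \<in> UNIV \<rightarrow>\<^sub>E {-1, 1}"
      by (auto simp: sign_vectors_def)
    then show "\<sigma> \<in> vec_lambda ` (UNIV \<rightarrow>\<^sub>E {-1, 1})"
      by (metis image_eqI vec_nth_inverse)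
  qed
  then show ?thesis
    by (rule finite_subset) (intro finite_imageI finite_PiE; simp)
qed

lemma sign_vectors_nonempty: "(sign_vectors :: (real ^ 'n) set) \<noteq> {}"
proof -
  have "(\<chi> j. 1) \<in> (sign_vectors :: (real ^ 'n) set)"
    by (simp add: sign_vectors_def)
  then show ?thesis by blast
qed

end

theory Submission
  imports Defs
begin

text \<open>The signs come from a deterministic walk in the cube, with $D = (1 + \log_+(n/9))^{1/4}$.
  Each row carries a level $k$: only its entries of size at most \<open>cut k\<close> are monitored, and the
  level rises once their total squared mass on the live columns is about $4^{-k}$. The entries dropped
  at level $k$ are large, hence their $\ell_1$ mass on the live columns is $O(2^{-k} D)$ and
  they can never do harm again. A monitored row has potential $G_i$, a cosh of its discrepancy times a
  decaying exponential of its remaining energy, and a live column $j$ has load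
  $h_j = \sum_i a_{ij}^2 G_i$. Bounding $\sum_j e^{\theta h_j}$ with $\theta \sim \log n$ keeps every
  load at most 2, so at any time only a constant fraction (in the number of live columns) of rows
  are heavy or at their allowed discrepancy, and these can be frozen.

  To move, one needs a direction $z$ orthogonal to the frozen rows along which the potential has
  nearly nonpositive second derivative. Its positive part factors as a composition of two maps of small
  Hilbert--Schmidt norm relative to the negative part; the smallness of the monitored entries makes the
  first factor small enough to beat $\theta$. Hence all directions orthogonal to a further constant
  fraction of exceptional ones are good, and a dimension count provides $z$.\<close>

section \<open>Directions avoiding large quadratic forms\<close>

lemma bessel_inequality:
  fixes E :: "'a::euclidean_space set"
  assumes "finite E" "pairwise orthogonal E" "\<And>e. e \<in> E \<Longrightarrow> norm e = 1"
  shows "(\<Sum>e\<in>E. (w \<bullet> e)\<^sup>2) \<le> (norm w)\<^sup>2"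
proof -
  define v where "v = (\<Sum>e\<in>E. (w \<bullet> e) *\<^sub>R e)"
  have ve: "v \<bullet> e = w \<bullet> e" if "e \<in> E" for e
  proof -
    have "v \<bullet> e = (\<Sum>e'\<in>E. (w \<bullet> e') * (e' \<bullet> e))"
      by (simp add: v_def inner_sum_left)
    also have "\<dots> = (\<Sum>e'\<in>E. if e' = e then w \<bullet> e else 0)"
    proof (rule sum.cong)
      fix e' assume "e' \<in> E"
      then show "(w \<bullet> e') * (e' \<bullet> e) = (if e' = e then w \<bullet> e else 0)"
        using assms(2,3) that by (auto simp: pairwise_def orthogonal_def norm_eq_1)
    qed simp
    finally show ?thesis using that \<open>finite E\<close> by simp
  qed
  have "v \<bullet> v = (\<Sum>e\<in>E. (w \<bullet> e) * (v \<bullet> e))"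
    by (subst (2) v_def) (simp add: inner_sum_right)
  also have "\<dots> = (\<Sum>e\<in>E. (w \<bullet> e)\<^sup>2)"
    by (simp add: ve power2_eq_square)
  finally have vv: "v \<bullet> v = (\<Sum>e\<in>E. (w \<bullet> e)\<^sup>2)" .
  have wv: "w \<bullet> v = (\<Sum>e\<in>E. (w \<bullet> e)\<^sup>2)"
    by (simp add: v_def inner_sum_right power2_eq_square)
  have "0 \<le> (w - v) \<bullet> (w - v)" by simp
  also have "\<dots> = w \<bullet> w - (\<Sum>e\<in>E. (w \<bullet> e)\<^sup>2)"
    by (simp add: inner_diff_left inner_diff_right inner_commute[of v w] vv wv)
  finally show ?thesis by (simp add: power2_norm_eq_inner)
qed

text \<open>The exceptional set is a maximal orthonormal set of directions violating the bound.\<close>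

lemma few_exceptional_directions:
  fixes w :: "'r \<Rightarrow> 'a::euclidean_space"
  assumes "c > 0"
  obtains E where "finite E" "real (card E) * c \<le> (\<Sum>r\<in>R. (norm (w r))\<^sup>2)"
    "\<And>z. (\<And>e. e \<in> E \<Longrightarrow> e \<bullet> z = 0) \<Longrightarrow> (\<Sum>r\<in>R. (w r \<bullet> z)\<^sup>2) \<le> c * (norm z)\<^sup>2"
proof -
  define Q where "Q E \<longleftrightarrow> finite E \<and> pairwise orthogonal E \<and>
    (\<forall>e\<in>E. norm e = 1 \<and> (\<Sum>r\<in>R. (w r \<bullet> e)\<^sup>2) > c)" for E
  have "card E \<le> DIM('a)" if "Q E" for E
  proof (rule independent_card_le)
    show "independent E"
      using that by (intro pairwise_orthogonal_independent) (auto simp: Q_def)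
  qed
  moreover have "Q {}" by (simp add: Q_def)
  ultimately obtain E where E: "Q E" and Emax: "\<And>E'. Q E' \<Longrightarrow> card E' \<le> card E"
    using ex_has_greatest_nat[of Q "{}" card "Suc DIM('a)"] by (metis le_imp_less_Suc)
  \<comment> \<open>Every element of \<open>E\<close> contributes more than \<open>c\<close>;
    exchanging the sums leaves one Bessel inequality per row.\<close>
  have "real (card E) * c = (\<Sum>e\<in>E. c)" by simp
  also have "\<dots> \<le> (\<Sum>e\<in>E. \<Sum>r\<in>R. (w r \<bullet> e)\<^sup>2)"
    using E by (intro sum_mono) (auto simp: Q_def less_imp_le)
  also have "\<dots> = (\<Sum>r\<in>R. \<Sum>e\<in>E. (w r \<bullet> e)\<^sup>2)" by (rule sum.swap)
  also have "\<dots> \<le> (\<Sum>r\<in>R. (norm (w r))\<^sup>2)"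
    using E by (intro sum_mono bessel_inequality) (auto simp: Q_def)
  finally have card: "real (card E) * c \<le> (\<Sum>r\<in>R. (norm (w r))\<^sup>2)" .
  have bound: "(\<Sum>r\<in>R. (w r \<bullet> z)\<^sup>2) \<le> c * (norm z)\<^sup>2" if z: "\<And>e. e \<in> E \<Longrightarrow> e \<bullet> z = 0" for z
  proof (rule ccontr)
    assume neg: "\<not> ?thesis"
    then have nz: "z \<noteq> 0" by auto
    define u where "u = z /\<^sub>R norm z"
    have "(\<Sum>r\<in>R. (w r \<bullet> u)\<^sup>2) = (\<Sum>r\<in>R. (w r \<bullet> z)\<^sup>2) / (norm z)\<^sup>2"
      by (simp add: u_def sum_divide_distrib power_divide divide_inverse[symmetric] mult.commute[of "inverse _"])
    also have "\<dots> > c" using neg nz by (simp add: field_simps)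
    finally have uc: "(\<Sum>r\<in>R. (w r \<bullet> u)\<^sup>2) > c" .
    have ue: "e \<bullet> u = 0" if "e \<in> E" for e using z[OF that] by (simp add: u_def)
    have un: "norm u = 1" using nz by (simp add: u_def)
    have "u \<notin> E"
    proof
      assume "u \<in> E"
      from ue[OF this] un show False by simp
    qed
    have "Q (insert u E)"
      using E uc ue un by (auto simp: Q_def pairwise_insert orthogonal_def inner_commute)
    from Emax[OF this] \<open>u \<notin> E\<close> E show False by (simp add: Q_def)
  qed
  show ?thesis using that[of E] E card bound by (auto simp: Q_def)
qed

text \<open>Vanishing off \<open>J\<close> is orthogonality to the axis vectors of the complement,
  so there are fewer linear conditions than dimensions.\<close>

lemma nonzero_orthogonal_on_support:
  fixes J :: "'n::finite set" and V :: "(real ^ 'n) set"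
  assumes "finite V" "card V < card J"
  obtains z where "z \<noteq> 0" "\<And>j. j \<notin> J \<Longrightarrow> z $ j = 0" "\<And>v. v \<in> V \<Longrightarrow> v \<bullet> z = 0"
proof -
  define U where "U = V \<union> (\<lambda>j. axis j 1) ` (- J)"
  have "finite U" using assms by (simp add: U_def)
  have "dim U \<le> card U" using \<open>finite U\<close> by (rule dim_le_card')
  also have "\<dots> \<le> card V + card (- J)"
    unfolding U_def by (meson card_Un_le card_image_le finite le_trans add_left_mono)
  also have "\<dots> < DIM(real ^ 'n)"
    using assms(2) card_Un_disjoint[of J "- J"] by (simp add: Compl_partition)
  finally obtain z where z: "z \<noteq> 0" "\<And>y. y \<in> span U \<Longrightarrow> orthogonal z y"
    by (rule orthogonal_to_subspace_exists) auto
  show ?thesis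
  proof (rule that[OF z(1)])
    show "z $ j = 0" if "j \<notin> J" for j
      using z(2)[of "axis j 1"] that by (auto simp: U_def span_base orthogonal_def inner_axis)
    show "v \<bullet> z = 0" if "v \<in> V" for v
      using z(2)[of v] that by (auto simp: U_def span_base orthogonal_def inner_commute)
  qed
qed

text \<open>A maximum at 0 would force \<open>f' 0 = 0\<close>; then \<open>f'\<close> is positive
  just to the right of 0, so \<open>f\<close> increases there.\<close>

lemma not_local_max_if_second_deriv_pos:
  fixes f f' :: "real \<Rightarrow> real"
  assumes f: "\<And>t. (f has_real_derivative f' t) (at t)"
    and f': "(f' has_real_derivative c) (at 0)" and "c > 0" "e > 0"
  shows "\<exists>t. \<bar>t\<bar> < e \<and> f t > f 0"
proof (rule ccontr)
  assume "\<not> ?thesis"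
  then have max: "f t \<le> f 0" if "\<bar>t\<bar> < e" for t using that by force
  then have "f' 0 = 0"
    using DERIV_local_max[OF f[of 0] \<open>e > 0\<close>] by simp
  then obtain d where d: "d > 0" "\<And>h. 0 < h \<Longrightarrow> h < d \<Longrightarrow> f' h > 0"
    using DERIV_pos_inc_right[OF f' \<open>c > 0\<close>] by auto
  define t where "t = min d e / 2"
  have t: "0 < t" "t < d" "t < e" using d(1) \<open>e > 0\<close> by (auto simp: t_def)
  have "f 0 < f t"
  proof (rule DERIV_pos_imp_increasing_open[OF t(1)])
    show "\<exists>y. (f has_real_derivative y) (at x) \<and> 0 < y" if "0 < x" "x < t" for x
      using f[of x] d(2)[of x] that t by auto
    show "continuous_on {0..t} f"
      by (meson f DERIV_isCont continuous_at_imp_continuous_on)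
  qed
  with max[of t] t show False by simp
qed

text \<open>A composition $X \circ Y$ is small off few directions if both factors have small
  Hilbert--Schmidt norm; \<^term>\<open>q\<close> is the diagonal form against which $Y$ is measured.\<close>

lemma decoupling_direction:
  fixes g e :: "'m::finite \<Rightarrow> real ^ 'n::finite" and J :: "'n set" and V :: "(real ^ 'n) set"
    and \<rho> \<tau> \<delta> :: real and \<omega> :: "'m \<Rightarrow> real" and q :: "'n \<Rightarrow> real" and X :: "'n \<Rightarrow> 'm \<Rightarrow> real"
  assumes q: "\<And>l. q l > 0" and \<omega>: "\<And>i. \<omega> i \<ge> 0" and pos: "\<rho> > 0" "\<tau> > 0" "\<delta> > 0" "J \<noteq> {}"
    and Y: "\<And>l. l \<in> J \<Longrightarrow> (\<Sum>i\<in>UNIV. \<omega> i * ((g i $ l)\<^sup>2 + (e i $ l)\<^sup>2)) \<le> \<rho> * q l"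
    and X: "(\<Sum>j\<in>J. \<Sum>i\<in>UNIV. (X j i)\<^sup>2) \<le> \<tau> * card J"
    and V: "finite V" "real (card V) + 2 * \<delta> * card J < card J"
  obtains z where "z \<noteq> 0" "\<And>j. j \<notin> J \<Longrightarrow> z $ j = 0" "\<And>v. v \<in> V \<Longrightarrow> v \<bullet> z = 0"
    "(\<Sum>i\<in>UNIV. \<omega> i * ((g i \<bullet> z)\<^sup>2 + (e i \<bullet> z)\<^sup>2)) \<le> \<rho> / \<delta> * (\<Sum>l\<in>J. q l * (z $ l)\<^sup>2)"
    "(\<Sum>j\<in>J. (\<Sum>i\<in>UNIV. X j i * sqrt (\<omega> i) * (g i \<bullet> z))\<^sup>2) \<le> \<tau> / \<delta> * (\<Sum>i\<in>UNIV. \<omega> i * (g i \<bullet> z)\<^sup>2)"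
proof -
  \<comment> \<open>On \<open>J\<close> the maps \<open>sc\<close> and \<open>rs\<close> rescale by
    inverse factors: the form with diagonal \<open>q\<close> becomes the squared Euclidean norm of
    \<open>rs z\<close>, while \<open>sc v \<bullet> rs z = v \<bullet> z\<close> for
    \<open>z\<close> supported on \<open>J\<close>.\<close>
  define sc where "sc v = (\<chi> l. if l \<in> J then v $ l / sqrt (q l) else 0)" for v :: "real ^ 'n"
  define rs where "rs v = (\<chi> l. if l \<in> J then v $ l * sqrt (q l) else 0)" for v :: "real ^ 'n"
  \<comment> \<open>The vectors \<open>g i\<close> and \<open>e i\<close> are stacked into one
    family, so that one exceptional set serves both.\<close>
  define w where "w r = (case r of (i, True) \<Rightarrow> sqrt (\<omega> i) *\<^sub>R sc (g i) | (i, False) \<Rightarrow> sqrt (\<omega> i) *\<^sub>R sc (e i))"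
    for r :: "'m \<times> bool"
  have sum_w: "(\<Sum>r\<in>UNIV. F (w r)) = (\<Sum>i\<in>UNIV. F (sqrt (\<omega> i) *\<^sub>R sc (g i)) + F (sqrt (\<omega> i) *\<^sub>R sc (e i)))"
    for F :: "real ^ 'n \<Rightarrow> real"
  proof -
    have "(\<Sum>r\<in>UNIV. F (w r)) = (\<Sum>i\<in>UNIV. \<Sum>b\<in>UNIV. F (w (i, b)))"
      by (simp add: sum.cartesian_product)
    then show ?thesis by (simp add: UNIV_bool w_def add.commute)
  qed
  have nsc: "(norm (sc v))\<^sup>2 = (\<Sum>l\<in>J. (v $ l)\<^sup>2 / q l)" for v
    using q unfolding power2_norm_eq_inner inner_vec_def sc_def
    by (simp add: if_distrib power2_eq_square[symmetric] power_divide less_imp_le sum.If_cases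
        cong: if_cong)
  have "(\<Sum>r\<in>UNIV. (norm (w r))\<^sup>2) = (\<Sum>i\<in>UNIV. \<Sum>l\<in>J. \<omega> i * ((g i $ l)\<^sup>2 + (e i $ l)\<^sup>2) / q l)"
    using \<omega> by (subst sum_w) (simp add: nsc power_mult_distrib sum_distrib_left sum.distrib[symmetric]
        add_divide_distrib distrib_left)
  also have "\<dots> = (\<Sum>l\<in>J. (\<Sum>i\<in>UNIV. \<omega> i * ((g i $ l)\<^sup>2 + (e i $ l)\<^sup>2)) / q l)"
    by (subst sum.swap) (simp add: sum_divide_distrib)
  also have "\<dots> \<le> (\<Sum>l\<in>J. \<rho>)"
    using q Y by (intro sum_mono) (simp add: pos_divide_le_eq)
  finally have w_le: "(\<Sum>r\<in>UNIV. (norm (w r))\<^sup>2) \<le> \<rho> * card J" by (simp add: mult.commute)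
  \<comment> \<open>The threshold \<open>\<rho> / \<delta>\<close> leaves at most
    \<open>\<delta> * card J\<close> exceptional directions; \<open>E2\<close> below is treated
    alike.\<close>
  obtain E1 where E1: "finite E1" "real (card E1) * (\<rho> / \<delta>) \<le> (\<Sum>r\<in>UNIV. (norm (w r))\<^sup>2)"
    "\<And>z. (\<And>e. e \<in> E1 \<Longrightarrow> e \<bullet> z = 0) \<Longrightarrow> (\<Sum>r\<in>UNIV. (w r \<bullet> z)\<^sup>2) \<le> \<rho> / \<delta> * (norm z)\<^sup>2"
    using few_exceptional_directions[where c = "\<rho> / \<delta>" and R = UNIV and w = w] pos by auto
  define x where "x j = (\<chi> i. X j i)" for j
  have "(\<Sum>j\<in>J. (norm (x j))\<^sup>2) \<le> \<tau> * card J"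
    using X unfolding power2_norm_eq_inner inner_vec_def x_def by (simp add: power2_eq_square)
  moreover obtain E2 where E2: "finite E2" "real (card E2) * (\<tau> / \<delta>) \<le> (\<Sum>j\<in>J. (norm (x j))\<^sup>2)"
    "\<And>z. (\<And>e. e \<in> E2 \<Longrightarrow> e \<bullet> z = 0) \<Longrightarrow> (\<Sum>j\<in>J. (x j \<bullet> z)\<^sup>2) \<le> \<tau> / \<delta> * (norm z)\<^sup>2"
    using few_exceptional_directions[where c = "\<tau> / \<delta>" and R = J and w = x] pos by auto
  ultimately have "real (card E2) * (\<tau> / \<delta>) \<le> \<tau> * card J" by simp
  then have c2: "real (card E2) \<le> \<delta> * card J" using pos by (simp add: field_simps)
  have "real (card E1) * (\<rho> / \<delta>) \<le> \<rho> * card J" using E1(2) w_le by simp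
  then have c1: "real (card E1) \<le> \<delta> * card J" using pos by (simp add: field_simps)
  \<comment> \<open>\<open>E2\<close> lives in row space. Its elements are pulled back along the map
    sending \<open>z\<close> to the vector of \<open>sqrt (\<omega> i) * (g i \<bullet> z)\<close>,
    so that they become linear conditions on \<open>z\<close>.\<close>
  define V2 where "V2 = (\<lambda>e. \<Sum>i\<in>UNIV. (e $ i * sqrt (\<omega> i)) *\<^sub>R g i) ` E2"
  define U where "U = V \<union> rs ` E1 \<union> V2"
  have "card U \<le> card V + card E1 + card E2"
    unfolding U_def V2_def using E1(1) E2(1)
    by (meson card_Un_le card_image_le le_trans add_mono order_refl)
  then have "real (card U) < real (card J)"
    using c1 c2 V(2) by linarith
  then obtain z where z: "z \<noteq> 0" "\<And>j. j \<notin> J \<Longrightarrow> z $ j = 0" "\<And>v. v \<in> U \<Longrightarrow> v \<bullet> z = 0"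
    using nonzero_orthogonal_on_support[of U J] E1(1) E2(1) V(1)
    by (auto simp: U_def V2_def)
  have scrs: "sc v \<bullet> rs z = v \<bullet> z" for v
    unfolding inner_vec_def sc_def rs_def using z(2) q
    by (intro sum.cong) (auto simp: less_imp_neq[symmetric])
  have rsn: "(norm (rs z))\<^sup>2 = (\<Sum>l\<in>J. q l * (z $ l)\<^sup>2)"
    unfolding power2_norm_eq_inner inner_vec_def rs_def using q
    by (simp add: if_distrib power2_eq_square[symmetric] power_mult_distrib less_imp_le sum.If_cases
        mult.commute cong: if_cong)
  have rse: "e \<bullet> rs z = rs e \<bullet> z" for e
    unfolding inner_vec_def rs_def by (intro sum.cong) (auto simp: z(2))
  have "(\<Sum>r\<in>UNIV. (w r \<bullet> rs z)\<^sup>2) \<le> \<rho> / \<delta> * (norm (rs z))\<^sup>2"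
    by (intro E1(3)) (auto simp: rse U_def intro: z(3))
  also have "(\<Sum>r\<in>UNIV. (w r \<bullet> rs z)\<^sup>2) = (\<Sum>i\<in>UNIV. \<omega> i * ((g i \<bullet> z)\<^sup>2 + (e i \<bullet> z)\<^sup>2))"
    using \<omega> by (subst sum_w) (simp add: scrs power_mult_distrib distrib_left)
  finally have 1: "(\<Sum>i\<in>UNIV. \<omega> i * ((g i \<bullet> z)\<^sup>2 + (e i \<bullet> z)\<^sup>2)) \<le> \<rho> / \<delta> * (\<Sum>l\<in>J. q l * (z $ l)\<^sup>2)"
    by (simp add: rsn)
  define v where "v = (\<chi> i. sqrt (\<omega> i) * (g i \<bullet> z))"
  have ev: "e \<bullet> v = (\<Sum>i\<in>UNIV. (e $ i * sqrt (\<omega> i)) *\<^sub>R g i) \<bullet> z" for e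
    by (simp add: v_def inner_vec_def[of e] inner_sum_left mult.assoc)
  have "(\<Sum>j\<in>J. (x j \<bullet> v)\<^sup>2) \<le> \<tau> / \<delta> * (norm v)\<^sup>2"
    by (intro E2(3)) (auto simp: ev U_def V2_def intro!: z(3))
  moreover have "(norm v)\<^sup>2 = (\<Sum>i\<in>UNIV. \<omega> i * (g i \<bullet> z)\<^sup>2)"
    using \<omega> unfolding power2_norm_eq_inner inner_vec_def[of v] unfolding v_def
    by (intro sum.cong) (simp_all add: power2_eq_square algebra_simps)
  moreover have "x j \<bullet> v = (\<Sum>i\<in>UNIV. X j i * sqrt (\<omega> i) * (g i \<bullet> z))" for j
    by (simp add: x_def v_def inner_vec_def[of "vec_lambda _" "vec_lambda _"] mult.assoc)
  ultimately have 2: "(\<Sum>j\<in>J. (\<Sum>i\<in>UNIV. X j i * sqrt (\<omega> i) * (g i \<bullet> z))\<^sup>2) \<le> \<tau> / \<delta> * (\<Sum>i\<in>UNIV. \<omega> i * (g i \<bullet> z)\<^sup>2)"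
    by simp
  show ?thesis using that[OF z(1,2) _ 1 2] z(3) by (auto simp: U_def)
qed

section \<open>The column potential\<close>

text \<open>\<open>b\<close> is the anchor from which the discrepancy is measured. The energy in the
  exponential is concave along every line, and this pays for the convexity of the cosh.\<close>

definition row_potential :: "real \<Rightarrow> real \<Rightarrow> real \<Rightarrow> real \<Rightarrow> real ^ 'n \<Rightarrow> real ^ 'n \<Rightarrow> real" where
  "row_potential p l f b s x =
    p * cosh (l * (s \<bullet> x - b)) * exp (f * (\<Sum>j\<in>UNIV. (s $ j)\<^sup>2 * (1 - (x $ j)\<^sup>2)))"

definition tilt :: "real \<Rightarrow> real \<Rightarrow> real ^ 'n \<Rightarrow> real ^ 'n \<Rightarrow> real" where
  "tilt l b s x = tanh (l * (s \<bullet> x - b))"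

text \<open>The gradient of the logarithm of \<open>row_potential\<close>.\<close>

definition log_grad :: "real \<Rightarrow> real \<Rightarrow> real \<Rightarrow> real ^ 'n \<Rightarrow> real ^ 'n \<Rightarrow> real ^ 'n" where
  "log_grad l f b s x = (\<chi> j. l * tilt l b s x * s $ j - 2 * f * (s $ j)\<^sup>2 * x $ j)"

text \<open>The outer square of this vector is the Hessian of log cosh (l (s \<bullet> x -
  b)).\<close>

definition curv :: "real \<Rightarrow> real \<Rightarrow> real ^ 'n \<Rightarrow> real ^ 'n \<Rightarrow> real ^ 'n" where
  "curv l b s x = (sqrt (1 - (tilt l b s x)\<^sup>2) * l) *\<^sub>R s"

section \<open>Derivatives of a single row potential\<close>

lemma tilt_sq_le_1: "(tilt l b s x)\<^sup>2 \<le> 1"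
  using tanh_real_bounds[of "l * (s \<bullet> x - b)"]
  by (simp add: tilt_def abs_square_le_1 abs_le_iff)

text \<open>With T the tilt, u = l |s_j| and v = 2 f s_j^2, the left side is at most (|T| u + v)^2 +
  (1 - T^2) u^2 = u^2 + v^2 + 2 |T| u v, and |T| \<le> 1.\<close>

lemma log_grad_curv_le:
  assumes "\<bar>x $ j\<bar> \<le> 1" "l \<ge> 0" "f \<ge> 0"
  shows "(log_grad l f b s x $ j)\<^sup>2 + (curv l b s x $ j)\<^sup>2 \<le> (l * \<bar>s $ j\<bar> + 2 * f * (s $ j)\<^sup>2)\<^sup>2"
proof -
  define T where "T = tilt l b s x"
  have T: "T\<^sup>2 \<le> 1" by (simp add: T_def tilt_sq_le_1)
  then have T1: "\<bar>T\<bar> \<le> 1" by (simp add: abs_square_le_1)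
  define u v where "u = l * \<bar>s $ j\<bar>" and "v = 2 * f * (s $ j)\<^sup>2"
  have uv: "u \<ge> 0" "v \<ge> 0" using assms by (auto simp: u_def v_def)
  have "\<bar>log_grad l f b s x $ j\<bar> \<le> \<bar>l * T * s $ j\<bar> + \<bar>2 * f * (s $ j)\<^sup>2 * x $ j\<bar>"
    by (simp add: log_grad_def T_def)
  also have "\<dots> = \<bar>T\<bar> * u + v * \<bar>x $ j\<bar>"
    using assms by (simp add: abs_mult u_def v_def)
  also have "\<dots> \<le> \<bar>T\<bar> * u + v"
    using assms uv by (simp add: mult_left_le)
  finally have "\<bar>log_grad l f b s x $ j\<bar>\<^sup>2 \<le> (\<bar>T\<bar> * u + v)\<^sup>2"
    by (intro power_mono) auto
  then have 1: "(log_grad l f b s x $ j)\<^sup>2 \<le> (\<bar>T\<bar> * u + v)\<^sup>2" by simp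
  have 2: "(curv l b s x $ j)\<^sup>2 = (1 - T\<^sup>2) * u\<^sup>2"
    using T by (simp add: curv_def power_mult_distrib u_def T_def[symmetric])
  have "(\<bar>T\<bar> * u + v)\<^sup>2 + (1 - T\<^sup>2) * u\<^sup>2 = u\<^sup>2 + v\<^sup>2 + 2 * \<bar>T\<bar> * (u * v)"
    by (simp add: power2_sum power_mult_distrib algebra_simps)
  also have "\<dots> \<le> u\<^sup>2 + v\<^sup>2 + 2 * (u * v)"
    using mult_right_mono[OF T1, of "u * v"] uv by simp
  also have "\<dots> = (u + v)\<^sup>2" by (simp add: power2_sum)
  finally show ?thesis using 1 2 by (simp add: u_def v_def)
qed

text \<open>On a line the inner product is affine and the energy quadratic in t, so the derivatives
  are explicit. The second derivative of cosh is split by tilt^2 + (1 - tilt^2) = 1: the first part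
  completes the square of the log-gradient, the second is the curvature term.\<close>

lemma row_potential_derivatives:
  fixes s x z :: "real ^ 'n" and p l f b :: real
  defines "R \<equiv> row_potential p l f b s"
  obtains R1 where "\<And>t. ((\<lambda>t. R (x + t *\<^sub>R z)) has_real_derivative R1 t) (at t)"
    "R1 0 = R x * (log_grad l f b s x \<bullet> z)"
    "(R1 has_real_derivative R x * ((log_grad l f b s x \<bullet> z)\<^sup>2 + (curv l b s x \<bullet> z)\<^sup>2
        - 2 * f * (\<Sum>j\<in>UNIV. (s $ j)\<^sup>2 * (z $ j)\<^sup>2))) (at 0)"
proof -
  define E e w where "E = (\<Sum>j\<in>UNIV. (s $ j)\<^sup>2 * (1 - (x $ j)\<^sup>2))"
    and "e = (\<Sum>j\<in>UNIV. (s $ j)\<^sup>2 * (x $ j * z $ j))" and "w = (\<Sum>j\<in>UNIV. (s $ j)\<^sup>2 * (z $ j)\<^sup>2)"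
  define y u where "y = s \<bullet> x - b" and "u = s \<bullet> z"
  define T where "T = tilt l b s x"
  have line: "R (x + t *\<^sub>R z) = p * cosh (l * (y + t * u)) * exp (f * (E - 2 * t * e - t\<^sup>2 * w))" for t
  proof -
    have "(\<Sum>j\<in>UNIV. (s $ j)\<^sup>2 * (1 - ((x + t *\<^sub>R z) $ j)\<^sup>2)) = E - 2 * t * e - t\<^sup>2 * w"
      unfolding E_def e_def w_def
      by (simp add: sum_distrib_left sum_subtractf[symmetric] power2_eq_square algebra_simps)
    moreover have "s \<bullet> (x + t *\<^sub>R z) - b = y + t * u"
      by (simp add: y_def u_def inner_add_right)
    ultimately show ?thesis by (simp add: R_def row_potential_def)
  qed
  define R1 where "R1 t = p * exp (f * (E - 2 * t * e - t\<^sup>2 * w)) *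
      (l * u * sinh (l * (y + t * u)) - 2 * f * (e + t * w) * cosh (l * (y + t * u)))" for t
  have sT: "sinh (l * y) = T * cosh (l * y)"
    by (simp add: T_def tilt_def y_def tanh_def)
  have R0: "R x = p * cosh (l * y) * exp (f * E)"
    using line[of 0] by simp
  have g: "log_grad l f b s x \<bullet> z = l * T * u - 2 * f * e"
    by (simp add: log_grad_def inner_vec_def u_def e_def T_def sum_distrib_left sum_subtractf[symmetric]
        algebra_simps)
  have c: "(curv l b s x \<bullet> z)\<^sup>2 = (1 - T\<^sup>2) * l\<^sup>2 * u\<^sup>2"
    using tilt_sq_le_1[of l b s x] by (simp add: curv_def u_def T_def power_mult_distrib)
  show ?thesis
  proof (rule that)
    show "((\<lambda>t. R (x + t *\<^sub>R z)) has_real_derivative R1 t) (at t)" for t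
      unfolding line R1_def
      by (auto intro!: derivative_eq_intros simp: algebra_simps)
    show "R1 0 = R x * (log_grad l f b s x \<bullet> z)"
      by (simp add: R1_def R0 g sT algebra_simps)
    show "(R1 has_real_derivative R x * ((log_grad l f b s x \<bullet> z)\<^sup>2 + (curv l b s x \<bullet> z)\<^sup>2
        - 2 * f * (\<Sum>j\<in>UNIV. (s $ j)\<^sup>2 * (z $ j)\<^sup>2))) (at 0)"
      unfolding R1_def g c R0 w_def[symmetric]
      by (auto intro!: derivative_eq_intros simp: sT algebra_simps power2_eq_square)
  qed
qed

text \<open>\<open>J\<close> is the live set and \<open>\<theta>\<close> the exponent of the loads.
  \<open>drift\<close> bounds gradient and curvature by \<open>\<rho>\<close> times the decay form,
  \<open>\<tau>\<close> bounds a trace, and each of two exceptional sets takes a share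
  \<open>\<delta>\<close> of the dimensions. \<open>balance\<close> makes the positive terms fit
  under the factor 2 of the negative one.\<close>

locale column_potential =
  fixes s :: "'m::finite \<Rightarrow> real ^ 'n::finite" and p l f b :: "'m \<Rightarrow> real"
    and \<theta> \<rho> \<tau> \<delta> :: real and J :: "'n set"
  assumes p_pos: "\<And>i. p i > 0" and l_nonneg: "\<And>i. l i \<ge> 0" and f_nonneg: "\<And>i. f i \<ge> 0"
    and param_pos: "\<theta> > 0" "\<rho> > 0" "\<tau> > 0" "\<delta> > 0"
    and drift: "\<And>i j. (l i * \<bar>s i $ j\<bar> + 2 * f i * (s i $ j)\<^sup>2)\<^sup>2 \<le> \<rho> * (f i * (s i $ j)\<^sup>2)"
    and balance: "\<rho> / \<delta> * (1 + \<theta> * (\<tau> / \<delta>)) \<le> 2"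
begin

definition G :: "'m \<Rightarrow> real ^ 'n \<Rightarrow> real" where
  "G i x = row_potential (p i) (l i) (f i) (b i) (s i) x"

definition load :: "'n \<Rightarrow> real ^ 'n \<Rightarrow> real" where
  "load j x = (\<Sum>i\<in>UNIV. (s i $ j)\<^sup>2 * G i x)"

definition \<Phi> :: "real ^ 'n \<Rightarrow> real" where
  "\<Phi> x = (\<Sum>j\<in>J. exp (\<theta> * load j x))"

text \<open>The second derivative of \<open>\<Phi>\<close> along \<open>z\<close> by the chain rule,
  as shown in \<open>potential_second_variation\<close>.\<close>

definition second_variation :: "real ^ 'n \<Rightarrow> real ^ 'n \<Rightarrow> real" where
  "second_variation x z = (\<Sum>j\<in>J. exp (\<theta> * load j x) *
       (\<theta> * (\<Sum>i\<in>UNIV. (s i $ j)\<^sup>2 * (G i x * ((log_grad (l i) (f i) (b i) (s i) x \<bullet> z)\<^sup>2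
           + (curv (l i) (b i) (s i) x \<bullet> z)\<^sup>2 - 2 * f i * (\<Sum>k\<in>UNIV. (s i $ k)\<^sup>2 * (z $ k)\<^sup>2))))
        + (\<theta> * (\<Sum>i\<in>UNIV. (s i $ j)\<^sup>2 * (G i x * (log_grad (l i) (f i) (b i) (s i) x \<bullet> z))))\<^sup>2))"

lemma G_pos: "G i x > 0"
  by (simp add: G_def row_potential_def p_pos cosh_real_pos)

text \<open>Exchanging sums turns the part linear in \<open>\<theta>\<close> into F - 2 D with row
  weights \<open>\<omega>\<close>. The squared load derivatives factor through the map bounded by F,
  hence add at most \<open>\<tau> / \<delta> * F\<close> up to \<open>\<theta>\<close>; by
  \<open>balance\<close>, 2 D absorbs everything except |z|^2.\<close>

lemma descent_direction:
  assumes J_nonempty: "J \<noteq> {}" and x: "\<And>j. \<bar>x $ j\<bar> \<le> 1"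
    and mm: "\<And>i j. j \<in> J \<Longrightarrow> f i \<noteq> 0 \<Longrightarrow> (s i $ j)\<^sup>2 \<le> mm i"
    and trace: "(\<Sum>i\<in>UNIV. if f i = 0 then 0 else mm i * G i x) \<le> \<tau> * card J"
    and B: "real (card B) + 2 * \<delta> * card J < card J"
  obtains z where "z \<noteq> 0" "\<And>j. j \<notin> J \<Longrightarrow> z $ j = 0" "\<And>i. i \<in> B \<Longrightarrow> s i \<bullet> z = 0"
    "second_variation x z \<le> (norm z)\<^sup>2"
proof -
  define w where "w j = exp (\<theta> * load j x)" for j
  define \<pi> where "\<pi> i = (\<Sum>j\<in>J. w j * (s i $ j)\<^sup>2)" for i
  define \<omega> where "\<omega> i = \<pi> i * G i x" for i
  \<comment> \<open>The summand \<open>1 / (2 * \<theta>)\<close> keeps \<open>q\<close> positive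
    and in the end costs exactly the error |z|^2 of the conclusion.\<close>
  define q where "q k = (\<Sum>i\<in>UNIV. \<omega> i * (f i * (s i $ k)\<^sup>2)) + 1 / (2 * \<theta>)" for k
  define g where "g i = log_grad (l i) (f i) (b i) (s i) x" for i
  define e where "e i = curv (l i) (b i) (s i) x" for i
  \<comment> \<open>Up to \<open>sqrt (w j)\<close>, this times \<open>sqrt (\<omega> i)\<close> is
    the coefficient of row \<open>i\<close> in the derivative of load \<open>j\<close>. Summed over
    \<open>j\<close>, its squares form a weighted average, whence the bound
    \<open>mm i * G i x\<close>. Rows with \<open>f i = 0\<close> may be left out, since
    \<open>drift\<close> makes their log-gradient vanish.\<close>
  define X where "X j i = (if f i = 0 then 0 else sqrt (w j) * (s i $ j)\<^sup>2 * sqrt (G i x / \<pi> i))" for j i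
  have w: "w j > 0" for j by (simp add: w_def)
  have Gp: "G i x > 0" for i by (rule G_pos)
  have \<pi>: "\<pi> i \<ge> 0" for i unfolding \<pi>_def using w by (intro sum_nonneg) (simp add: less_imp_le)
  have \<omega>: "\<omega> i \<ge> 0" for i using \<pi> Gp by (simp add: \<omega>_def less_imp_le)
  have q: "q k > 0" for k
    using param_pos \<omega> f_nonneg by (simp add: q_def sum_nonneg add_nonneg_pos)
  have Y: "(\<Sum>i\<in>UNIV. \<omega> i * ((g i $ k)\<^sup>2 + (e i $ k)\<^sup>2)) \<le> \<rho> * q k" for k
  proof -
    have "(\<Sum>i\<in>UNIV. \<omega> i * ((g i $ k)\<^sup>2 + (e i $ k)\<^sup>2)) \<le> (\<Sum>i\<in>UNIV. \<omega> i * (\<rho> * (f i * (s i $ k)\<^sup>2)))"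
      unfolding g_def e_def using \<omega>
      by (intro sum_mono mult_left_mono order_trans[OF log_grad_curv_le drift])
         (auto simp: x l_nonneg f_nonneg)
    also have "\<dots> = \<rho> * (\<Sum>i\<in>UNIV. \<omega> i * (f i * (s i $ k)\<^sup>2))"
      by (simp add: sum_distrib_left mult.left_commute)
    also have "\<dots> \<le> \<rho> * q k" using param_pos by (simp add: q_def)
    finally show ?thesis .
  qed
  have "(\<Sum>j\<in>J. \<Sum>i\<in>UNIV. (X j i)\<^sup>2) = (\<Sum>i\<in>UNIV. \<Sum>j\<in>J. (X j i)\<^sup>2)" by (rule sum.swap)
  also have "\<dots> \<le> (\<Sum>i\<in>UNIV. if f i = 0 then 0 else mm i * G i x)"
  proof (rule sum_mono)
    fix i
    show "(\<Sum>j\<in>J. (X j i)\<^sup>2) \<le> (if f i = 0 then 0 else mm i * G i x)"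
    proof (cases "f i = 0")
      case False
      have mm0: "mm i \<ge> 0" using mm[OF _ False] J_nonempty by (meson ex_in_conv order_trans zero_le_power2)
      have "(\<Sum>j\<in>J. (X j i)\<^sup>2) = (\<Sum>j\<in>J. w j * (s i $ j)\<^sup>2 * (s i $ j)\<^sup>2 * (G i x / \<pi> i))"
      proof (rule sum.cong)
        fix j
        have "(X j i)\<^sup>2 = (sqrt (w j))\<^sup>2 * ((s i $ j)\<^sup>2 * (s i $ j)\<^sup>2) * (sqrt (G i x / \<pi> i))\<^sup>2"
          using False by (simp add: X_def power_mult_distrib power2_eq_square[of "(s i $ j)\<^sup>2"])
        also have "\<dots> = w j * ((s i $ j)\<^sup>2 * (s i $ j)\<^sup>2) * (G i x / \<pi> i)"
          using less_imp_le[OF w[of j]] less_imp_le[OF Gp[of i]] \<pi>[of i]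
          by (subst (1 2) real_sqrt_pow2) auto
        finally show "(X j i)\<^sup>2 = w j * (s i $ j)\<^sup>2 * (s i $ j)\<^sup>2 * (G i x / \<pi> i)" by (simp only: mult.assoc)
      qed simp
      also have "\<dots> \<le> (\<Sum>j\<in>J. w j * (s i $ j)\<^sup>2 * mm i * (G i x / \<pi> i))"
        using False w \<pi> Gp mm
        by (intro sum_mono mult_right_mono mult_left_mono) (auto simp: less_imp_le)
      also have "\<dots> = \<pi> i * (mm i * (G i x / \<pi> i))"
        by (simp only: mult.assoc \<pi>_def sum_distrib_right)
      also have "\<dots> \<le> mm i * G i x"
        using mm0 Gp[of i] by (cases "\<pi> i = 0") auto
      finally show ?thesis using False by simp
    qed (simp add: X_def)
  qed
  also note trace
  finally have X: "(\<Sum>j\<in>J. \<Sum>i\<in>UNIV. (X j i)\<^sup>2) \<le> \<tau> * card J" .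
  have "card (s ` B) \<le> card B" by (intro card_image_le) simp
  then have V: "real (card (s ` B)) + 2 * \<delta> * card J < card J" using B by linarith
  obtain z where z: "z \<noteq> 0" "\<And>j. j \<notin> J \<Longrightarrow> z $ j = 0" "\<And>v. v \<in> s ` B \<Longrightarrow> v \<bullet> z = 0"
    and zY: "(\<Sum>i\<in>UNIV. \<omega> i * ((g i \<bullet> z)\<^sup>2 + (e i \<bullet> z)\<^sup>2)) \<le> \<rho> / \<delta> * (\<Sum>k\<in>J. q k * (z $ k)\<^sup>2)"
    and zX: "(\<Sum>j\<in>J. (\<Sum>i\<in>UNIV. X j i * sqrt (\<omega> i) * (g i \<bullet> z))\<^sup>2) \<le> \<tau> / \<delta> * (\<Sum>i\<in>UNIV. \<omega> i * (g i \<bullet> z)\<^sup>2)"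
    using decoupling_direction[OF q \<omega> param_pos(2-4) J_nonempty Y X _ V] by auto
  define F where "F = (\<Sum>i\<in>UNIV. \<omega> i * ((g i \<bullet> z)\<^sup>2 + (e i \<bullet> z)\<^sup>2))"
  define D where "D = (\<Sum>i\<in>UNIV. \<omega> i * (f i * (\<Sum>k\<in>UNIV. (s i $ k)\<^sup>2 * (z $ k)\<^sup>2)))"
  have Xg: "X j i * sqrt (\<omega> i) * (g i \<bullet> z) = sqrt (w j) * ((s i $ j)\<^sup>2 * (G i x * (g i \<bullet> z)))"
    if "j \<in> J" for i j
  proof (cases "f i = 0")
    case True
    then have "(l i * \<bar>s i $ k\<bar>)\<^sup>2 \<le> 0" for k using drift[of i k] by simp
    then have "l i * s i $ k = 0" for k by (metis abs_eq_0 mult_eq_0_iff power2_less_eq_zero_iff)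
    then have "g i = 0" using True
      by (auto simp: g_def log_grad_def vec_eq_iff)
    then show ?thesis by simp
  next
    case False
    show ?thesis
    proof (cases "\<pi> i = 0")
      case True
      then have "w j * (s i $ j)\<^sup>2 = 0"
        using that w unfolding \<pi>_def by (subst (asm) sum_nonneg_eq_0_iff) (auto simp: less_imp_le)
      then have "s i $ j = 0" using w[of j] by simp
      then show ?thesis by (simp add: X_def)
    next
      case pne: False
      then have "sqrt (G i x / \<pi> i) * sqrt (\<omega> i) = G i x"
        using \<pi>[of i] Gp[of i] by (simp add: \<omega>_def real_sqrt_mult[symmetric])
      then show ?thesis using False by (simp add: X_def mult.assoc)
    qed
  qed
  have "(\<Sum>j\<in>J. (\<Sum>i\<in>UNIV. X j i * sqrt (\<omega> i) * (g i \<bullet> z))\<^sup>2)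
      = (\<Sum>j\<in>J. w j * (\<Sum>i\<in>UNIV. (s i $ j)\<^sup>2 * (G i x * (g i \<bullet> z)))\<^sup>2)"
    using w by (intro sum.cong) (simp_all add: Xg sum_distrib_left[symmetric] power_mult_distrib less_imp_le)
  moreover have "(\<Sum>i\<in>UNIV. \<omega> i * (g i \<bullet> z)\<^sup>2) \<le> F"
    unfolding F_def using \<omega> by (intro sum_mono mult_left_mono) auto
  ultimately have 1: "(\<Sum>j\<in>J. w j * (\<Sum>i\<in>UNIV. (s i $ j)\<^sup>2 * (G i x * (g i \<bullet> z)))\<^sup>2) \<le> \<tau> / \<delta> * F"
    using zX param_pos by (smt (verit) divide_pos_pos mult_left_mono)
  have swap: "(\<Sum>j\<in>J. w j * (\<Sum>i\<in>UNIV. (s i $ j)\<^sup>2 * (G i x * c i))) = (\<Sum>i\<in>UNIV. \<omega> i * c i)" for c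
  proof -
    have "(\<Sum>j\<in>J. w j * (\<Sum>i\<in>UNIV. (s i $ j)\<^sup>2 * (G i x * c i)))
        = (\<Sum>i\<in>UNIV. \<Sum>j\<in>J. w j * (s i $ j)\<^sup>2 * (G i x * c i))"
      by (subst sum.swap) (simp add: sum_distrib_left mult.assoc)
    then show ?thesis by (simp add: \<omega>_def \<pi>_def sum_distrib_right mult.assoc)
  qed
  have expand: "(\<Sum>j\<in>J. w j * (\<theta> * \<alpha> j + (\<theta> * \<beta> j)\<^sup>2))
      = \<theta> * (\<Sum>j\<in>J. w j * \<alpha> j) + \<theta>\<^sup>2 * (\<Sum>j\<in>J. w j * (\<beta> j)\<^sup>2)" for \<alpha> \<beta> :: "'n \<Rightarrow> real"
    by (simp add: sum.distrib sum_distrib_left algebra_simps power_mult_distrib)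
  have "(\<Sum>j\<in>J. w j * (\<theta> * (\<Sum>i\<in>UNIV. (s i $ j)\<^sup>2 * (G i x * ((g i \<bullet> z)\<^sup>2
           + (e i \<bullet> z)\<^sup>2 - 2 * f i * (\<Sum>k\<in>UNIV. (s i $ k)\<^sup>2 * (z $ k)\<^sup>2))))
        + (\<theta> * (\<Sum>i\<in>UNIV. (s i $ j)\<^sup>2 * (G i x * (g i \<bullet> z))))\<^sup>2))
      = \<theta> * (\<Sum>j\<in>J. w j * (\<Sum>i\<in>UNIV. (s i $ j)\<^sup>2 * (G i x * ((g i \<bullet> z)\<^sup>2
           + (e i \<bullet> z)\<^sup>2 - 2 * f i * (\<Sum>k\<in>UNIV. (s i $ k)\<^sup>2 * (z $ k)\<^sup>2)))))
        + \<theta>\<^sup>2 * (\<Sum>j\<in>J. w j * (\<Sum>i\<in>UNIV. (s i $ j)\<^sup>2 * (G i x * (g i \<bullet> z)))\<^sup>2)"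
    by (rule expand)
  also have "(\<Sum>j\<in>J. w j * (\<Sum>i\<in>UNIV. (s i $ j)\<^sup>2 * (G i x * ((g i \<bullet> z)\<^sup>2
           + (e i \<bullet> z)\<^sup>2 - 2 * f i * (\<Sum>k\<in>UNIV. (s i $ k)\<^sup>2 * (z $ k)\<^sup>2))))) = F - 2 * D"
    unfolding swap F_def D_def
    by (simp add: sum_distrib_left sum_subtractf[symmetric] algebra_simps)
  also have "\<theta> * (F - 2 * D) + \<theta>\<^sup>2 * (\<Sum>j\<in>J. w j * (\<Sum>i\<in>UNIV. (s i $ j)\<^sup>2 * (G i x * (g i \<bullet> z)))\<^sup>2)
      \<le> \<theta> * (F - 2 * D) + \<theta>\<^sup>2 * (\<tau> / \<delta> * F)"
    using 1 by (intro add_left_mono mult_left_mono) auto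
  also have "\<dots> = \<theta> * ((1 + \<theta> * (\<tau> / \<delta>)) * F - 2 * D)"
    by (simp add: algebra_simps power2_eq_square)
  also have "\<dots> \<le> \<theta> * (2 * (\<Sum>k\<in>J. q k * (z $ k)\<^sup>2) - 2 * D)"
  proof -
    have "(1 + \<theta> * (\<tau> / \<delta>)) * F \<le> (1 + \<theta> * (\<tau> / \<delta>)) * (\<rho> / \<delta> * (\<Sum>k\<in>J. q k * (z $ k)\<^sup>2))"
      using zY param_pos unfolding F_def by (intro mult_left_mono) (auto intro!: add_nonneg_nonneg)
    also have "\<dots> = (\<rho> / \<delta> * (1 + \<theta> * (\<tau> / \<delta>))) * (\<Sum>k\<in>J. q k * (z $ k)\<^sup>2)" by (simp add: mult_ac)
    also have "\<dots> \<le> 2 * (\<Sum>k\<in>J. q k * (z $ k)\<^sup>2)"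
      using balance q by (intro mult_right_mono sum_nonneg) (auto simp: less_imp_le)
    finally show ?thesis using param_pos by (intro mult_left_mono) auto
  qed
  also have "(\<Sum>k\<in>J. q k * (z $ k)\<^sup>2) = (\<Sum>k\<in>UNIV. q k * (z $ k)\<^sup>2)"
    by (intro sum.mono_neutral_left) (auto simp: z(2))
  also have "\<dots> = D + (norm z)\<^sup>2 / (2 * \<theta>)"
  proof -
    have "(\<Sum>k\<in>UNIV. (\<Sum>i\<in>UNIV. \<omega> i * (f i * (s i $ k)\<^sup>2)) * (z $ k)\<^sup>2) = D"
      unfolding D_def sum_distrib_left sum_distrib_right by (subst sum.swap) (simp add: mult_ac)
    moreover have "(\<Sum>k\<in>UNIV. 1 / (2 * \<theta>) * (z $ k)\<^sup>2) = (norm z)\<^sup>2 / (2 * \<theta>)"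
      unfolding power2_norm_eq_inner inner_vec_def
      by (simp add: sum_divide_distrib[symmetric] power2_eq_square)
    ultimately show ?thesis by (simp add: q_def distrib_right sum.distrib)
  qed
  also have "\<theta> * (2 * (D + (norm z)\<^sup>2 / (2 * \<theta>)) - 2 * D) = (norm z)\<^sup>2"
    using param_pos by (simp add: field_simps)
  finally show ?thesis
    using that[of z] z unfolding second_variation_def w_def g_def e_def by blast
qed

section \<open>Moving until a live coordinate reaches a sign\<close>

lemma potential_second_variation:
  fixes x z :: "real ^ 'n"
  obtains \<Phi>1 where "\<And>t. ((\<lambda>t. \<Phi> (x + t *\<^sub>R z)) has_real_derivative \<Phi>1 t) (at t)"
    "(\<Phi>1 has_real_derivative second_variation x z) (at 0)"
proof -
  define a where "a i = log_grad (l i) (f i) (b i) (s i) x \<bullet> z" for i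
  define c where "c i = a i ^ 2 + (curv (l i) (b i) (s i) x \<bullet> z)\<^sup>2
      - 2 * f i * (\<Sum>k\<in>UNIV. (s i $ k)\<^sup>2 * (z $ k)\<^sup>2)" for i
  have "\<exists>R1. (\<forall>t. ((\<lambda>t. G i (x + t *\<^sub>R z)) has_real_derivative R1 t) (at t)) \<and> R1 0 = G i x * a i
      \<and> (R1 has_real_derivative G i x * c i) (at 0)" for i
    unfolding G_def a_def c_def
    by (rule row_potential_derivatives[of "p i" "l i" "f i" "b i" "s i" x z]) blast
  then have "\<forall>i. \<exists>R1. (\<forall>t. ((\<lambda>t. G i (x + t *\<^sub>R z)) has_real_derivative R1 t) (at t)) \<and> R1 0 = G i x * a i
      \<and> (R1 has_real_derivative G i x * c i) (at 0)" by blast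
  from choice[OF this] obtain R1 where
    R1: "\<And>i t. ((\<lambda>t. G i (x + t *\<^sub>R z)) has_real_derivative R1 i t) (at t)"
    "\<And>i. R1 i 0 = G i x * a i" "\<And>i. (R1 i has_real_derivative G i x * c i) (at 0)"
    by blast
  define L1 where "L1 j t = (\<Sum>i\<in>UNIV. (s i $ j)\<^sup>2 * R1 i t)" for j t
  have L: "((\<lambda>t. load j (x + t *\<^sub>R z)) has_real_derivative L1 j t) (at t)" for j t
    unfolding load_def L1_def by (intro DERIV_sum DERIV_cmult R1)
  have L2: "(L1 j has_real_derivative (\<Sum>i\<in>UNIV. (s i $ j)\<^sup>2 * (G i x * c i))) (at 0)" for j
    unfolding L1_def by (intro DERIV_sum DERIV_cmult R1)
  define \<Phi>1 where "\<Phi>1 t = (\<Sum>j\<in>J. exp (\<theta> * load j (x + t *\<^sub>R z)) * (\<theta> * L1 j t))" for t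
  have 1: "((\<lambda>t. \<Phi> (x + t *\<^sub>R z)) has_real_derivative \<Phi>1 t) (at t)" for t
    unfolding \<Phi>_def \<Phi>1_def by (intro DERIV_sum) (auto intro!: derivative_eq_intros L)
  have 2: "(\<Phi>1 has_real_derivative (\<Sum>j\<in>J. exp (\<theta> * load j x) *
       (\<theta> * (\<Sum>i\<in>UNIV. (s i $ j)\<^sup>2 * (G i x * c i))
        + (\<theta> * (\<Sum>i\<in>UNIV. (s i $ j)\<^sup>2 * (G i x * a i)))\<^sup>2))) (at 0)"
    unfolding \<Phi>1_def
  proof (intro DERIV_sum)
    fix j
    have "L1 j 0 = (\<Sum>i\<in>UNIV. (s i $ j)\<^sup>2 * (G i x * a i))" by (simp add: L1_def R1(2))
    then show "((\<lambda>t. exp (\<theta> * load j (x + t *\<^sub>R z)) * (\<theta> * L1 j t)) has_real_derivative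
        exp (\<theta> * load j x) * (\<theta> * (\<Sum>i\<in>UNIV. (s i $ j)\<^sup>2 * (G i x * c i))
        + (\<theta> * (\<Sum>i\<in>UNIV. (s i $ j)\<^sup>2 * (G i x * a i)))\<^sup>2)) (at 0)"
      by (auto intro!: derivative_eq_intros L L2 simp: algebra_simps power2_eq_square)
  qed
  show ?thesis using that[OF 1] 2 unfolding second_variation_def c_def a_def by blast
qed

lemma continuous_on_potential: "continuous_on S \<Phi>"
  unfolding \<Phi>_def load_def G_def row_potential_def by (intro continuous_intros)

text \<open>Take the feasible point maximising $|x|^2 - \Phi$: if no live coordinate were $\pm 1$, the
  second derivative along a descent direction would be positive.\<close>

lemma freezing_step:
  fixes x0 :: "real ^ 'n" and d mm :: "'m \<Rightarrow> real"
  defines "feas x \<equiv> (\<forall>j. \<bar>x $ j\<bar> \<le> 1) \<and> (\<forall>j. j \<notin> J \<longrightarrow> x $ j = x0 $ j) \<and> (\<forall>i. \<bar>s i \<bullet> x - b i\<bar> \<le> d i)"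
  assumes J_nonempty: "J \<noteq> {}" and x0: "feas x0" "\<Phi> x0 \<le> M + (norm x0)\<^sup>2"
    and mm: "\<And>i j. j \<in> J \<Longrightarrow> f i \<noteq> 0 \<Longrightarrow> (s i $ j)\<^sup>2 \<le> mm i"
    and trace: "\<And>x. feas x \<Longrightarrow> \<Phi> x \<le> M + (norm x)\<^sup>2 \<Longrightarrow>
      (\<Sum>i\<in>UNIV. if f i = 0 then 0 else mm i * G i x) \<le> \<tau> * card J"
    and tight: "\<And>x. feas x \<Longrightarrow> \<Phi> x \<le> M + (norm x)\<^sup>2 \<Longrightarrow>
      real (card {i. s i \<noteq> 0 \<and> \<bar>s i \<bullet> x - b i\<bar> = d i}) + 2 * \<delta> * card J < card J"
  obtains x where "feas x" "\<Phi> x \<le> M + (norm x)\<^sup>2" "\<exists>j\<in>J. \<bar>x $ j\<bar> = 1"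
proof -
  define K where "K = {x. feas x}"
  have "K \<subseteq> cbox (\<chi> j. -1) (\<chi> j. 1)"
    unfolding K_def feas_def by (auto simp: mem_box_cart abs_le_iff)
  moreover have "closed K"
    unfolding K_def feas_def Collect_conj_eq Collect_all_eq imp_conv_disj Collect_disj_eq
    by (intro closed_Int closed_INT ballI closed_Un closed_Collect_le closed_Collect_eq
        closed_Collect_const continuous_intros)
  ultimately have "compact K"
    by (metis compact_Int_closed compact_cbox inf.absorb_iff2)
  define F where "F x = (norm x)\<^sup>2 - \<Phi> x" for x
  have "continuous_on K F"
    unfolding F_def by (intro continuous_intros continuous_on_potential)
  moreover have "x0 \<in> K" using x0 by (simp add: K_def)
  ultimately obtain x where x: "x \<in> K" "\<And>y. y \<in> K \<Longrightarrow> F y \<le> F x"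
    using continuous_attains_sup[OF \<open>compact K\<close>, of F] by blast
  have feas: "feas x" using x(1) by (simp add: K_def)
  \<comment> \<open>Comparing the maximiser with \<open>x0\<close> carries the potential bound over
    with the same \<open>M\<close>.\<close>
  have \<Phi>x: "\<Phi> x \<le> M + (norm x)\<^sup>2"
    using x(2)[OF \<open>x0 \<in> K\<close>] x0(2) by (simp add: F_def)
  have "\<exists>j\<in>J. \<bar>x $ j\<bar> = 1"
  proof (rule ccontr)
    assume "\<not> ?thesis"
    then have lt1: "\<bar>x $ j\<bar> < 1" if "j \<in> J" for j
      using feas that unfolding feas_def by (meson order_le_less)
    \<comment> \<open>Only these rows block motion: zero rows never change, and rows strictly inside
      their width tolerate small steps.\<close>
    define B where "B = {i. s i \<noteq> 0 \<and> \<bar>s i \<bullet> x - b i\<bar> = d i}"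
    have xle: "\<bar>x $ j\<bar> \<le> 1" for j using feas by (simp add: feas_def)
    have Bc: "real (card B) + 2 * \<delta> * card J < card J"
      using tight[OF feas \<Phi>x] by (simp add: B_def)
    obtain z where z: "z \<noteq> 0" "\<And>j. j \<notin> J \<Longrightarrow> z $ j = 0" "\<And>i. i \<in> B \<Longrightarrow> s i \<bullet> z = 0"
      and curv: "second_variation x z \<le> (norm z)\<^sup>2"
      using descent_direction[OF J_nonempty xle mm trace[OF feas \<Phi>x] Bc] by blast
    obtain \<Phi>1 where \<Phi>1: "\<And>t. ((\<lambda>t. \<Phi> (x + t *\<^sub>R z)) has_real_derivative \<Phi>1 t) (at t)"
      "(\<Phi>1 has_real_derivative second_variation x z) (at 0)"
      using potential_second_variation[of x z] by blast
    define F1 where "F1 t = 2 * (x \<bullet> z) + 2 * t * (norm z)\<^sup>2 - \<Phi>1 t" for t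
    have norm_line: "(norm (x + t *\<^sub>R z))\<^sup>2 = (norm x)\<^sup>2 + 2 * t * (x \<bullet> z) + t\<^sup>2 * (norm z)\<^sup>2" for t
      unfolding power2_norm_eq_inner
      by (simp add: inner_add_left inner_add_right inner_commute[of z x] algebra_simps power2_eq_square)
    have D1: "((\<lambda>t. F (x + t *\<^sub>R z)) has_real_derivative F1 t) (at t)" for t
      unfolding F_def norm_line F1_def
      by (auto intro!: derivative_eq_intros \<Phi>1(1))
    have D2: "(F1 has_real_derivative 2 * (norm z)\<^sup>2 - second_variation x z) (at 0)"
      unfolding F1_def by (auto intro!: derivative_eq_intros \<Phi>1(2))
    \<comment> \<open>The squared norm gains 2 |z|^2, of which the potential takes back at most
      |z|^2.\<close>
    have pos: "2 * (norm z)\<^sup>2 - second_variation x z > 0"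
      using curv z(1) by (smt (verit) zero_less_norm_iff zero_less_power)
    have lim: "((\<lambda>t. \<bar>\<alpha> + t * \<beta>\<bar>) \<longlongrightarrow> \<bar>\<alpha>\<bar>) (nhds 0)" for \<alpha> \<beta> :: real
      by (auto intro!: tendsto_eq_intros filterlim_ident)
    have "\<forall>\<^sub>F t in nhds 0. \<forall>j\<in>J. \<bar>x $ j + t * z $ j\<bar> < 1"
      using lt1 by (intro eventually_ball_finite ballI order_tendstoD(2)[OF lim]) auto
    moreover have "\<forall>\<^sub>F t in nhds 0. \<forall>i\<in>{i. \<bar>s i \<bullet> x - b i\<bar> < d i}. \<bar>s i \<bullet> x - b i + t * (s i \<bullet> z)\<bar> < d i"
      by (intro eventually_ball_finite ballI order_tendstoD(2)[OF lim]) auto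
    ultimately have "\<forall>\<^sub>F t in nhds 0. x + t *\<^sub>R z \<in> K"
    proof eventually_elim
      case (elim t)
      have 1: "\<bar>(x + t *\<^sub>R z) $ j\<bar> \<le> 1" for j
        using elim(1) xle[of j] z(2)[of j] by (cases "j \<in> J") (auto simp: less_imp_le)
      have 2: "\<bar>s i \<bullet> (x + t *\<^sub>R z) - b i\<bar> \<le> d i" for i
      proof (cases "\<bar>s i \<bullet> x - b i\<bar> < d i")
        case True
        then have "\<bar>s i \<bullet> x - b i + t * (s i \<bullet> z)\<bar> < d i" using elim(2) by blast
        then show ?thesis by (simp add: inner_add_right algebra_simps)
      next
        case False
        then have "s i \<bullet> z = 0"
          using z(3)[of i] feas by (cases "s i = 0") (auto simp: B_def feas_def order_le_less)
        then show ?thesis using feas by (simp add: inner_add_right feas_def)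
      qed
      show ?case using 1 2 feas z(2) by (simp add: K_def feas_def)
    qed
    then obtain e where e: "e > 0" "\<And>t. \<bar>t\<bar> < e \<Longrightarrow> x + t *\<^sub>R z \<in> K"
      unfolding eventually_nhds_metric by (auto simp: dist_real_def)
    obtain t where "\<bar>t\<bar> < e" "F (x + t *\<^sub>R z) > F (x + 0 *\<^sub>R z)"
      using not_local_max_if_second_deriv_pos[OF D1 D2 pos e(1)] by blast
    with x(2)[OF e(2)[of t]] show False by simp
  qed
  then show ?thesis using that feas \<Phi>x by blast
qed

end

section \<open>Levels of rows\<close>

text \<open>\<open>K_large\<close> puts all nonzero entries above the cut of level \<open>K\<close>,
  so nothing is monitored there; \<open>log_size\<close> makes the load exponent
  \<open>3 * D ^ 4\<close> dominate ln (2n).\<close>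

locale komlos =
  fixes A :: "real ^ 'n::finite ^ 'm::finite" and D :: real and K :: nat
  assumes column_norm: "\<And>j. (\<Sum>i\<in>UNIV. (A $ i $ j)\<^sup>2) \<le> 1"
    and D_ge_1: "D \<ge> 1"
    and K_pos: "K > 0"
    and K_large: "\<And>i j. A $ i $ j \<noteq> 0 \<Longrightarrow> \<bar>A $ i $ j\<bar> > 2 / 5 / 2 ^ K / D"
    and log_size: "ln (2 * real CARD('n)) \<le> 3 * D ^ 4"
begin

text \<open>Its square is 4/125/D^2 times the weight threshold 5/4^k. Together with a gradient bound
  of the same order D^-2 this offsets the load exponent of order D^4.\<close>

definition cut :: "nat \<Rightarrow> real" where "cut k = 2 / 5 / 2 ^ k / D"

definition sub :: "'m \<Rightarrow> nat \<Rightarrow> real ^ 'n" where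
  "sub i k = (\<chi> j. if k = 0 \<or> \<bar>A $ i $ j\<bar> \<le> cut k then A $ i $ j else 0)"

definition weight :: "'m \<Rightarrow> nat \<Rightarrow> 'n set \<Rightarrow> real" where
  "weight i k J = (\<Sum>j\<in>J. (sub i k $ j)\<^sup>2)"

text \<open>The cap \<open>K\<close>, where \<open>sub\<close> vanishes, makes the level finite also for rows that never again
  become heavy. At level 0 the whole row is frozen.\<close>

definition level :: "'n set \<Rightarrow> 'm \<Rightarrow> nat" where
  "level J i = (LEAST k. k = K \<or> weight i k J > 5 / 4 ^ k)"

text \<open>The constants satisfy $(\mathit{rate} + 2\,\mathit{decay}\cdot\mathit{cut})^2 \le
  \mathit{decay}/(4D^2)$, the widths are summable, and the drop of \<open>base\<close> at each level
  absorbs the largest energy factor a row can have when it enters that level.\<close>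

definition base :: "nat \<Rightarrow> real" where "base k = exp (- 3 * (1 - (9/16) ^ k))"
definition rate :: "nat \<Rightarrow> real" where "rate k = (if k = 0 then 0 else (3/2) ^ k / (10 * D))"
definition decay :: "nat \<Rightarrow> real" where "decay k = (if k = 0 then 0 else (9/4) ^ k / 9)"
definition width :: "nat \<Rightarrow> real" where "width k = (if k = 0 then 0 else 240 * D * (3/4) ^ k)"
text \<open>The budget spent on reaching level \<open>k\<close>: each earlier level costs its width
  plus twice the absolute mass 25 D/2^l of the entries it drops, since points of the cube differ by
  at most 2 per coordinate.\<close>

definition slack :: "nat \<Rightarrow> real" where "slack k = (\<Sum>l<k. width l + 50 * D / 2 ^ l)"

definition rowpot :: "'n set \<Rightarrow> ('m \<Rightarrow> real) \<Rightarrow> 'm \<Rightarrow> real ^ 'n \<Rightarrow> real" where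
  "rowpot J b i x = row_potential (base (level J i)) (rate (level J i)) (decay (level J i)) (b i) (sub i (level J i)) x"

definition colload :: "'n set \<Rightarrow> ('m \<Rightarrow> real) \<Rightarrow> 'n \<Rightarrow> real ^ 'n \<Rightarrow> real" where
  "colload J b j x = (\<Sum>i\<in>UNIV. (sub i (level J i) $ j)\<^sup>2 * rowpot J b i x)"

definition pot :: "'n set \<Rightarrow> ('m \<Rightarrow> real) \<Rightarrow> real ^ 'n \<Rightarrow> real" where
  "pot J b x = (\<Sum>j\<in>J. exp (3 * D ^ 4 * colload J b j x))"

section \<open>Monotonicity of cuts, weights and levels\<close>

lemma cut_pos: "cut k > 0" using D_ge_1 by (simp add: cut_def)

lemma cut_antimono: "k \<le> k' \<Longrightarrow> cut k' \<le> cut k"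
  using D_ge_1 by (simp add: cut_def divide_left_mono divide_right_mono)

lemma width_nonneg: "width k \<ge> 0" using D_ge_1 by (simp add: width_def)
lemma rate_nonneg: "rate k \<ge> 0" using D_ge_1 by (simp add: rate_def)
lemma decay_nonneg: "decay k \<ge> 0" by (simp add: decay_def)

lemma sub_0: "sub i 0 = A $ i" by (simp add: sub_def vec_eq_iff)

lemma sub_K: "sub i K = 0"
proof -
  have "A $ i $ j = 0" if "\<bar>A $ i $ j\<bar> \<le> cut K" for j
    using K_large[of i j] that unfolding cut_def by linarith
  then show ?thesis using K_pos by (simp add: sub_def vec_eq_iff)
qed

lemma sub_sq_antimono:
  assumes "k \<le> k'" shows "(sub i k' $ j)\<^sup>2 \<le> (sub i k $ j)\<^sup>2"
  using cut_antimono[OF assms] assms by (auto simp: sub_def)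

lemma abs_sub_le_cut: "k > 0 \<Longrightarrow> \<bar>sub i k $ j\<bar> \<le> cut k"
  using cut_pos[of k] by (auto simp: sub_def)

lemma weight_mono:
  assumes "J' \<subseteq> J" "k \<le> k'" shows "weight i k' J' \<le> weight i k J"
proof -
  have "weight i k' J' \<le> weight i k J'"
    unfolding weight_def by (intro sum_mono sub_sq_antimono assms)
  also have "\<dots> \<le> weight i k J"
    unfolding weight_def using assms by (intro sum_mono2) auto
  finally show ?thesis .
qed

lemma level_le_K: "level J i \<le> K"
  unfolding level_def by (rule Least_le) simp

lemma weight_le_below_level: "k < level J i \<Longrightarrow> weight i k J \<le> 5 / 4 ^ k"
  unfolding level_def using not_less_Least by fastforce

lemma weight_gt_at_level: "level J i < K \<Longrightarrow> weight i (level J i) J > 5 / 4 ^ level J i"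
  using LeastI[of "\<lambda>k. k = K \<or> weight i k J > 5 / 4 ^ k" K]
  unfolding level_def by auto

text \<open>The level for \<open>J'\<close> already meets the defining condition for
  \<open>J\<close>, where weights are larger; minimality does the rest.\<close>

lemma level_mono:
  assumes "J' \<subseteq> J" shows "level J i \<le> level J' i"
  unfolding level_def[of J]
proof (rule Least_le)
  show "level J' i = K \<or> weight i (level J' i) J > 5 / 4 ^ level J' i"
    using weight_gt_at_level[of J' i] weight_mono[OF assms order_refl, of i "level J' i"] level_le_K[of J' i]
    by fastforce
qed

text \<open>The preceding level failed its threshold, which is four times the present one, and a
  finer cut only removes entries.\<close>

lemma weight_le_at_level:
  assumes "level J i > 0" shows "weight i (level J i) J \<le> 20 / 4 ^ level J i"
proof -
  obtain k where k: "level J i = Suc k" using assms by (cases "level J i") auto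
  have "weight i (Suc k) J \<le> weight i k J" by (rule weight_mono) auto
  also have "\<dots> \<le> 5 / 4 ^ k" by (rule weight_le_below_level) (simp add: k)
  finally show ?thesis by (simp add: k)
qed

section \<open>Row potentials at a given level\<close>

lemma base_0: "base 0 = 1" by (simp add: base_def)

lemma base_pos: "base k > 0" by (simp add: base_def)

lemma base_antimono: "k \<le> k' \<Longrightarrow> base k' \<le> base k"
  by (simp add: base_def power_decreasing)

lemma base_ge: "base k \<ge> exp (- 3)" by (simp add: base_def)

text \<open>With u = (9/16)^k the exponent of \<open>base\<close> falls by 21/16 u, while the energy
  factor contributes only 5/4 u.\<close>

lemma base_Suc: "base (Suc k) * exp (decay (Suc k) * (20 / 4 ^ Suc k)) \<le> base k"
proof -
  define u :: real where "u = (9/16) ^ k"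
  have "(9/4) ^ k / 4 ^ k = u" by (simp add: u_def power_divide[symmetric])
  then have "decay (Suc k) * (20 / 4 ^ Suc k) = 5/4 * u" by (simp add: decay_def field_simps)
  moreover have "u \<ge> 0" by (simp add: u_def)
  ultimately show ?thesis by (simp add: base_def u_def[symmetric] exp_add[symmetric])
qed

text \<open>Coordinates of modulus 1 carry no energy, so only the live weight counts.\<close>

lemma energy_bounds:
  assumes "\<And>j. \<bar>x $ j\<bar> \<le> 1"
  shows "0 \<le> (\<Sum>j\<in>UNIV. (sub i k $ j)\<^sup>2 * (1 - (x $ j)\<^sup>2))"
    and "(\<And>j. j \<notin> J \<Longrightarrow> \<bar>x $ j\<bar> = 1) \<Longrightarrow>
      (\<Sum>j\<in>UNIV. (sub i k $ j)\<^sup>2 * (1 - (x $ j)\<^sup>2)) \<le> weight i k J"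
proof -
  have sq: "(x $ j)\<^sup>2 \<le> 1" for j using assms by (simp add: abs_square_le_1)
  show "0 \<le> (\<Sum>j\<in>UNIV. (sub i k $ j)\<^sup>2 * (1 - (x $ j)\<^sup>2))"
    using sq by (intro sum_nonneg mult_nonneg_nonneg) auto
  assume off: "\<And>j. j \<notin> J \<Longrightarrow> \<bar>x $ j\<bar> = 1"
  have "(x $ j)\<^sup>2 = 1" if "j \<notin> J" for j using off[OF that] by (simp add: abs_square_eq_1)
  then have "(\<Sum>j\<in>UNIV. (sub i k $ j)\<^sup>2 * (1 - (x $ j)\<^sup>2)) = (\<Sum>j\<in>J. (sub i k $ j)\<^sup>2 * (1 - (x $ j)\<^sup>2))"
    by (intro sum.mono_neutral_right) auto
  also have "\<dots> \<le> weight i k J"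
    unfolding weight_def by (intro sum_mono) (simp add: mult_left_le)
  finally show "(\<Sum>j\<in>UNIV. (sub i k $ j)\<^sup>2 * (1 - (x $ j)\<^sup>2)) \<le> weight i k J" .
qed

lemma base_le_rowpot:
  assumes "\<And>j. \<bar>x $ j\<bar> \<le> 1"
  shows "base (level J i) * cosh (rate (level J i) * (sub i (level J i) \<bullet> x - b i)) \<le> rowpot J b i x"
proof -
  let ?k = "level J i"
  have "exp (decay ?k * (\<Sum>j\<in>UNIV. (sub i ?k $ j)\<^sup>2 * (1 - (x $ j)\<^sup>2))) \<ge> 1"
    using energy_bounds(1)[OF assms, of i ?k] decay_nonneg[of ?k] by simp
  from mult_left_mono[OF this, of "base ?k * cosh (rate ?k * (sub i ?k \<bullet> x - b i))"] show ?thesis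
    using base_pos[of ?k] by (simp add: rowpot_def row_potential_def less_imp_le)
qed

lemma rowpot_pos: "rowpot J b i x > 0"
  by (simp add: rowpot_def row_potential_def base_pos)

text \<open>A row anchored at its present value has cosh 1; only the energy factor remains, and the
  drop of \<open>base\<close> pays for it.\<close>

lemma fresh_rowpot_le:
  assumes "\<And>j. \<bar>x $ j\<bar> \<le> 1" "\<And>j. j \<notin> J \<Longrightarrow> \<bar>x $ j\<bar> = 1"
    and "b i = sub i (level J i) \<bullet> x"
  shows "rowpot J b i x \<le> base (level J i - 1)"
proof (cases "level J i")
  case 0
  \<comment> \<open>Here rate and decay vanish, and truncated subtraction makes the bound
    \<open>base 0\<close>.\<close>
  then show ?thesis by (simp add: rowpot_def row_potential_def rate_def decay_def)
next
  case (Suc k)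
  have "(\<Sum>j\<in>UNIV. (sub i (Suc k) $ j)\<^sup>2 * (1 - (x $ j)\<^sup>2)) \<le> 20 / 4 ^ Suc k"
    using energy_bounds(2)[where x = x and J = J and i = i and k = "Suc k"] assms(1,2)
      weight_le_at_level[of J i] Suc by force
  from mult_left_mono[OF this decay_nonneg[of "Suc k"]]
  have "rowpot J b i x \<le> base (Suc k) * exp (decay (Suc k) * (20 / 4 ^ Suc k))"
    using assms(3) base_pos[of "Suc k"]
    by (simp add: rowpot_def row_potential_def Suc del: power_Suc)
  also have "\<dots> \<le> base k" by (rule base_Suc)
  finally show ?thesis by (simp add: Suc)
qed

text \<open>The left side of \<open>balance\<close> is 1/D^2 + 96/125. For \<open>drift\<close>, in
  units of (3/2)^k / D, \<open>rate\<close> gives 1/10 and the cut limits the energy term to 1/15;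
  their sum 1/6 squares to the decay over 4 D^2.\<close>

lemma level_potential:
  "column_potential (\<lambda>i. sub i (level J i)) (\<lambda>i. base (level J i)) (\<lambda>i. rate (level J i))
     (\<lambda>i. decay (level J i)) (3 * D ^ 4) (1 / (4 * D\<^sup>2)) (8 / 125 / D\<^sup>2) (1 / 4)"
proof
  show "base (level J i) > 0" "rate (level J i) \<ge> 0" "decay (level J i) \<ge> 0" for i
    by (rule base_pos rate_nonneg decay_nonneg)+
  show "0 < 3 * D ^ 4" "0 < 1 / (4 * D\<^sup>2)" "0 < 8 / 125 / D\<^sup>2" "(0::real) < 1 / 4"
    using D_ge_1 by auto
  show "1 / (4 * D\<^sup>2) / (1 / 4) * (1 + 3 * D ^ 4 * (8 / 125 / D\<^sup>2 / (1 / 4))) \<le> 2"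
  proof -
    have "D\<^sup>2 \<ge> 1" using D_ge_1 by simp
    moreover have "D ^ 4 = D\<^sup>2 * D\<^sup>2" by (simp flip: power_add)
    ultimately have "1 / (4 * D\<^sup>2) / (1 / 4) * (1 + 3 * D ^ 4 * (8 / 125 / D\<^sup>2 / (1 / 4))) = 1 / D\<^sup>2 + 96 / 125"
      using D_ge_1 by (simp add: field_simps)
    also have "\<dots> \<le> 2" using \<open>D\<^sup>2 \<ge> 1\<close> by (smt (verit) divide_le_eq_1)
    finally show ?thesis .
  qed
  fix i j
  define k where "k = level J i"
  define c where "c = \<bar>sub i k $ j\<bar>"
  have "(rate k * c + 2 * decay k * c\<^sup>2)\<^sup>2 \<le> 1 / (4 * D\<^sup>2) * (decay k * c\<^sup>2)"
  proof (cases "k = 0")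
    case False
    then have c: "c \<le> cut k" "c \<ge> 0" by (auto simp: c_def abs_sub_le_cut)
    have eq: "(9/4) ^ k = (3/2) ^ k * ((3/2) ^ k :: real)"
      by (subst power_mult_distrib[symmetric]) simp
    have "(9/4) ^ k / 2 ^ k = (3/2) ^ k * ((3/2) ^ k / 2 ^ k :: real)" by (simp only: eq times_divide_eq_right)
    also have "(3/2) ^ k / 2 ^ k = ((3/4) ^ k :: real)"
      by (subst power_divide[symmetric]) simp
    \<comment> \<open>Here \<open>k \<ge> 1\<close> enters: the factor 3/4 turns the constant 4/45
      into 1/15.\<close>
    also have "(3/2) ^ k * (3/4) ^ k \<le> (3/2) ^ k * ((3/4) ^ 1 :: real)"
      using False by (intro mult_left_mono power_decreasing) auto
    finally have "(9/4) ^ k / 2 ^ k \<le> (3/2) ^ k * (3/4 :: real)" by simp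
    then have "2 * decay k * cut k \<le> (3/2) ^ k / (15 * D)"
      using False D_ge_1 by (simp add: decay_def cut_def field_simps)
    moreover have "2 * decay k * c \<le> 2 * decay k * cut k"
      using c decay_nonneg by (intro mult_left_mono) auto
    ultimately have "rate k + 2 * decay k * c \<le> (3/2) ^ k / (10 * D) + (3/2) ^ k / (15 * D)"
      using False by (simp add: rate_def)
    also have "\<dots> = (3/2) ^ k / (6 * D)" using D_ge_1 by (simp add: field_simps)
    finally have "(rate k + 2 * decay k * c)\<^sup>2 \<le> ((3/2) ^ k / (6 * D))\<^sup>2"
      using c rate_nonneg decay_nonneg by (intro power_mono add_nonneg_nonneg mult_nonneg_nonneg) auto
    also have "\<dots> = 1 / (4 * D\<^sup>2) * decay k"
    proof -
      have "(v / (6 * D))\<^sup>2 = 1 / (4 * D\<^sup>2) * (v * v / 9)" for v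
        by (simp add: power2_eq_square)
      moreover have "decay k = (3/2) ^ k * (3/2) ^ k / 9"
        using False by (simp only: decay_def eq if_False)
      ultimately show ?thesis by (simp only:)
    qed
    finally have "(rate k + 2 * decay k * c)\<^sup>2 * c\<^sup>2 \<le> 1 / (4 * D\<^sup>2) * decay k * c\<^sup>2"
      by (intro mult_right_mono) auto
    moreover have "rate k * c + 2 * decay k * c\<^sup>2 = (rate k + 2 * decay k * c) * c"
      by (simp add: algebra_simps power2_eq_square)
    ultimately show ?thesis by (simp only: power_mult_distrib mult.assoc)
  qed (simp add: rate_def decay_def)
  then show "(rate (level J i) * \<bar>sub i (level J i) $ j\<bar> + 2 * decay (level J i) * (sub i (level J i) $ j)\<^sup>2)\<^sup>2
      \<le> 1 / (4 * D\<^sup>2) * (decay (level J i) * (sub i (level J i) $ j)\<^sup>2)"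
    by (simp add: k_def c_def)
qed

text \<open>An entry dropped between levels l and l + 1 exceeds \<open>cut (Suc l)\<close> in
  modulus, so it is at most its square over that cut. The weight bound 5/4^l then gives 25
  D/2^l.\<close>

lemma sub_band_le:
  assumes "k \<le> k'" "\<And>l. l < k' \<Longrightarrow> weight i l J \<le> 5 / 4 ^ l"
  shows "(\<Sum>j\<in>J. \<bar>sub i k $ j - sub i k' $ j\<bar>) \<le> (\<Sum>l\<in>{k..<k'}. 25 * D / 2 ^ l)"
  using assms
proof (induction k' rule: dec_induct)
  case (step l)
  have "\<bar>sub i l $ j - sub i (Suc l) $ j\<bar> \<le> (sub i l $ j)\<^sup>2 / cut (Suc l)" for j
  proof (cases "sub i (Suc l) $ j = sub i l $ j")
    case False
    then have "\<not> \<bar>A $ i $ j\<bar> \<le> cut (Suc l)" "sub i (Suc l) $ j = 0"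
      using cut_antimono[of l "Suc l"] by (auto simp: sub_def split: if_splits)
    moreover have "sub i l $ j = A $ i $ j" using False calculation by (auto simp: sub_def split: if_splits)
    ultimately have "\<bar>sub i l $ j\<bar> * cut (Suc l) \<le> \<bar>sub i l $ j\<bar> * \<bar>sub i l $ j\<bar>"
      by (intro mult_left_mono) auto
    then show ?thesis
      using cut_pos[of "Suc l"] \<open>sub i (Suc l) $ j = 0\<close> by (simp add: pos_le_divide_eq power2_eq_square)
  qed (simp add: cut_pos less_imp_le)
  then have "(\<Sum>j\<in>J. \<bar>sub i l $ j - sub i (Suc l) $ j\<bar>) \<le> (\<Sum>j\<in>J. (sub i l $ j)\<^sup>2 / cut (Suc l))"
    by (intro sum_mono) auto
  also have "\<dots> = weight i l J / cut (Suc l)" by (simp add: weight_def sum_divide_distrib)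
  also have "\<dots> \<le> 5 / 4 ^ l / cut (Suc l)"
    using step.prems[of l] cut_pos[of "Suc l"] by (intro divide_right_mono) auto
  also have "\<dots> = 25 * D / 2 ^ l"
  proof -
    have "(4::real) ^ l = 2 ^ l * 2 ^ l" by (subst power_mult_distrib[symmetric]) simp
    then show ?thesis by (simp add: cut_def)
  qed
  finally have "(\<Sum>j\<in>J. \<bar>sub i l $ j - sub i (Suc l) $ j\<bar>) \<le> 25 * D / 2 ^ l" .
  moreover have "(\<Sum>j\<in>J. \<bar>sub i k $ j - sub i l $ j\<bar>) \<le> (\<Sum>l\<in>{k..<l}. 25 * D / 2 ^ l)"
    using step by simp
  moreover have "(\<Sum>j\<in>J. \<bar>sub i k $ j - sub i (Suc l) $ j\<bar>)
      \<le> (\<Sum>j\<in>J. \<bar>sub i k $ j - sub i l $ j\<bar> + \<bar>sub i l $ j - sub i (Suc l) $ j\<bar>)"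
    by (intro sum_mono) auto
  ultimately show ?case using step.hyps by (simp add: sum.distrib)
qed simp

text \<open>The widths give at most 240 D times the geometric sum 3 of (3/4)^l over l \<ge> 1, the
  dropped entries at most 50 D times 2.\<close>

lemma slack_width_le: "slack k + width k \<le> 820 * D"
proof -
  have "(\<Sum>l<k. 1 / 2 ^ l) = (2 - 2 / 2 ^ k :: real)" for k by (induction k) (auto simp: field_simps)
  then have "(\<Sum>l<k. 1 / 2 ^ l) \<le> (2 :: real)" by simp
  then have 1: "(\<Sum>l<k. 50 * D / 2 ^ l) \<le> 100 * D"
    using D_ge_1 mult_left_mono[of "\<Sum>l<k. 1 / 2 ^ l" 2 "50 * D"] by (simp add: sum_distrib_left)
  have "(\<Sum>l<k. width l) + width k \<le> 720 * D * (1 - (3/4) ^ k)" for k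
  proof (induction k)
    case 0 show ?case by (simp add: width_def)
  next
    case (Suc k)
    have "(\<Sum>l<Suc k. width l) + width (Suc k) \<le> 720 * D * (1 - (3/4) ^ k) + 240 * D * (3/4) ^ Suc k"
      using Suc by (simp add: width_def)
    also have "\<dots> = 720 * D * (1 - (3/4) ^ Suc k)" by (simp add: algebra_simps)
    finally show ?case .
  qed
  then have "(\<Sum>l<k. width l) + width k \<le> 720 * D * (1 - (3/4) ^ k)" .
  also have "\<dots> \<le> 720 * D" using D_ge_1 by (simp add: mult_left_le)
  finally show ?thesis using 1 by (simp add: slack_def sum.distrib)
qed

section \<open>Consequences of the potential bound\<close>

lemma norm_sq_le_card: "(\<And>j. \<bar>x $ j\<bar> \<le> 1) \<Longrightarrow> (norm x)\<^sup>2 \<le> real CARD('n)" for x :: "real ^ 'n"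
proof -
  assume "\<And>j. \<bar>x $ j\<bar> \<le> 1"
  then have "(x $ j)\<^sup>2 \<le> 1" for j by (simp add: abs_square_le_1)
  then have "(\<Sum>j\<in>UNIV. (x $ j)\<^sup>2) \<le> (\<Sum>j\<in>(UNIV :: 'n set). 1)" by (intro sum_mono)
  then show ?thesis unfolding power2_norm_eq_inner inner_vec_def by (simp add: power2_eq_square)
qed

text \<open>A single term of \<open>pot\<close> is at most n exp \<theta> + n \<le> 2 n exp
  \<theta>; take logarithms and use ln (2n) \<le> \<theta>.\<close>

lemma colload_le_2:
  assumes x: "\<And>j. \<bar>x $ j\<bar> \<le> 1" and pot: "pot J b x \<le> real CARD('n) * exp (3 * D ^ 4) + (norm x)\<^sup>2" and "j \<in> J"
  shows "colload J b j x \<le> 2"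
proof -
  define \<theta> where "\<theta> = 3 * D ^ 4"
  have \<theta>: "\<theta> > 0" using D_ge_1 by (simp add: \<theta>_def)
  have "exp (\<theta> * colload J b j x) \<le> pot J b x"
    unfolding pot_def \<theta>_def by (rule member_le_sum[OF \<open>j \<in> J\<close>]) auto
  also have "\<dots> \<le> real CARD('n) * exp \<theta> + real CARD('n)" using pot norm_sq_le_card[OF x] by (simp add: \<theta>_def)
  also have "\<dots> \<le> 2 * real CARD('n) * exp \<theta>" using \<theta> by simp
  also have "\<dots> = exp (ln (2 * real CARD('n)) + \<theta>)" by (simp add: exp_add)
  finally have "\<theta> * colload J b j x \<le> ln (2 * real CARD('n)) + \<theta>" by simp
  also have "\<dots> \<le> \<theta> * 2" using log_size by (simp add: \<theta>_def)
  finally show ?thesis using \<theta> by simp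
qed

text \<open>Double counting turns the control of column loads into an average over rows, ready for
  Markov's inequality.\<close>

lemma sum_weight_rowpot_le:
  assumes "\<And>j. \<bar>x $ j\<bar> \<le> 1" and "pot J b x \<le> real CARD('n) * exp (3 * D ^ 4) + (norm x)\<^sup>2"
  shows "(\<Sum>i\<in>UNIV. weight i (level J i) J * rowpot J b i x) \<le> 2 * card J"
proof -
  have "(\<Sum>i\<in>UNIV. weight i (level J i) J * rowpot J b i x) = (\<Sum>j\<in>J. colload J b j x)"
    unfolding weight_def colload_def sum_distrib_right by (rule sum.swap)
  also have "\<dots> \<le> (\<Sum>j\<in>J. 2)" by (intro sum_mono colload_le_2 assms)
  finally show ?thesis by simp
qed

text \<open>Serves as \<open>mm\<close> in the trace condition. Level \<open>K\<close> gets 0: the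
  monitored part vanishes there, and no lower bound on the weight is available.\<close>

definition cutoff_sq :: "'n set \<Rightarrow> 'm \<Rightarrow> real" where
  "cutoff_sq J i = (if level J i = K then 0 else (cut (level J i))\<^sup>2)"

lemma sub_sq_le_cutoff_sq:
  assumes "decay (level J i) \<noteq> 0" shows "(sub i (level J i) $ j)\<^sup>2 \<le> cutoff_sq J i"
proof (cases "level J i = K")
  case False
  have "level J i > 0" using assms by (cases "level J i = 0") (simp_all add: decay_def)
  then have "\<bar>sub i (level J i) $ j\<bar>\<^sup>2 \<le> (cut (level J i))\<^sup>2"
    by (intro power_mono abs_sub_le_cut) auto
  then show ?thesis using False by (simp add: cutoff_sq_def)
qed (simp add: cutoff_sq_def sub_K)

text \<open>Below level \<open>K\<close> the weight exceeds 5/4^k, so the squared cut is at most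
  4/125/D^2 times the weight; the load bound 2 doubles the constant.\<close>

lemma trace_le:
  assumes x: "\<And>j. \<bar>x $ j\<bar> \<le> 1" and pot: "pot J b x \<le> real CARD('n) * exp (3 * D ^ 4) + (norm x)\<^sup>2"
  shows "(\<Sum>i\<in>UNIV. if decay (level J i) = 0 then 0 else cutoff_sq J i * rowpot J b i x)
    \<le> 8 / 125 / D\<^sup>2 * card J"
proof -
  have "cutoff_sq J i \<le> 4 / 125 / D\<^sup>2 * weight i (level J i) J" for i
  proof (cases "level J i = K")
    case True
    then show ?thesis by (simp add: cutoff_sq_def weight_def sum_nonneg)
  next
    case False
    then have "5 / 4 ^ level J i \<le> weight i (level J i) J"
      using weight_gt_at_level[of J i] level_le_K[of J i] by linarith
    then have "4 / 125 / D\<^sup>2 * (5 / 4 ^ level J i) \<le> 4 / 125 / D\<^sup>2 * weight i (level J i) J"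
      by (intro mult_left_mono) auto
    moreover have "cutoff_sq J i = 4 / 125 / D\<^sup>2 * (5 / 4 ^ level J i)"
    proof -
      have "(4::real) ^ k = 2 ^ k * 2 ^ k" for k by (subst power_mult_distrib[symmetric]) simp
      then show ?thesis using False by (simp add: cutoff_sq_def cut_def power2_eq_square)
    qed
    ultimately show ?thesis by simp
  qed
  then have "(if decay (level J i) = 0 then 0 else cutoff_sq J i * rowpot J b i x)
      \<le> 4 / 125 / D\<^sup>2 * (weight i (level J i) J * rowpot J b i x)" for i
    using mult_right_mono[of "cutoff_sq J i" "4 / 125 / D\<^sup>2 * weight i (level J i) J" "rowpot J b i x"]
      rowpot_pos[of J b i x]
    by (simp add: mult.assoc weight_def sum_nonneg less_imp_le)
  then have "(\<Sum>i\<in>UNIV. if decay (level J i) = 0 then 0 else cutoff_sq J i * rowpot J b i x)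
      \<le> 4 / 125 / D\<^sup>2 * (\<Sum>i\<in>UNIV. weight i (level J i) J * rowpot J b i x)"
    unfolding sum_distrib_left by (intro sum_mono)
  also have "\<dots> \<le> 4 / 125 / D\<^sup>2 * (2 * card J)"
    by (intro mult_left_mono sum_weight_rowpot_le x pot) auto
  finally show ?thesis by simp
qed

text \<open>Rate times width is 24 (9/8)^k \<ge> 24 + 3 k by Bernoulli, so the cosh is at least e^24
  4^k / 2. The power 4^k cancels the weight threshold 5/4^k, and \<open>base\<close> loses at most
  e^-3.\<close>

lemma tight_row_ge:
  assumes x: "\<And>j. \<bar>x $ j\<bar> \<le> 1" and "0 < level J i" "level J i < K"
    and tight: "\<bar>sub i (level J i) \<bullet> x - b i\<bar> = width (level J i)"
  shows "8 \<le> weight i (level J i) J * rowpot J b i x"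
proof -
  define k where "k = level J i"
  have "rate k * width k = 24 * (9/8) ^ k"
  proof -
    have "(9/8 :: real) ^ k = (3/2) ^ k * (3/4) ^ k" by (subst power_mult_distrib[symmetric]) simp
    then show ?thesis using assms(2) D_ge_1 by (simp add: rate_def width_def k_def)
  qed
  moreover have "1 + real k * (1/8) \<le> (1 + 1/8) ^ k" by (rule Bernoulli_inequality) simp
  ultimately have "24 + real k * 3 \<le> rate k * width k" by simp
  then have "exp 24 * exp 3 ^ k \<le> exp (rate k * width k)"
    by (simp flip: exp_add exp_of_nat_mult)
  moreover have "(4::real) ^ k \<le> exp 3 ^ k"
    using exp_ge_add_one_self[of 3] by (intro power_mono) auto
  ultimately have e: "exp 24 * 4 ^ k \<le> exp (rate k * width k)"
    by (smt (verit) exp_gt_zero mult_left_mono)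
  have "cosh (rate k * (sub i k \<bullet> x - b i)) = cosh (rate k * width k)"
    using tight rate_nonneg[of k] by (metis abs_mult abs_of_nonneg cosh_real_abs k_def)
  moreover have "exp (rate k * width k) / 2 \<le> cosh (rate k * width k)"
    by (simp add: cosh_def)
  ultimately have "exp 24 * 4 ^ k / 2 \<le> cosh (rate k * (sub i k \<bullet> x - b i))" using e by linarith
  then have "exp (- 3) * (exp 24 * 4 ^ k / 2) \<le> base k * cosh (rate k * (sub i k \<bullet> x - b i))"
    using base_ge[of k] base_pos[of k] by (intro mult_mono) auto
  also have "\<dots> \<le> rowpot J b i x"
    unfolding k_def by (rule base_le_rowpot[OF x])
  also have "exp (- 3) * (exp 24 * 4 ^ k / 2) = exp 21 * 4 ^ k / (2 :: real)"
    by (simp flip: exp_add)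
  finally have "exp 21 * 4 ^ k / 2 \<le> rowpot J b i x" .
  then have "5 / 4 ^ k * (exp 21 * 4 ^ k / 2) \<le> weight i k J * rowpot J b i x"
    using weight_gt_at_level[OF assms(3)] by (intro mult_mono) (auto simp: k_def weight_def sum_nonneg)
  moreover have "(8::real) \<le> 5 / 4 ^ k * (exp 21 * 4 ^ k / 2)"
    using exp_ge_add_one_self[of 21] by simp
  ultimately show ?thesis by (simp add: k_def)
qed

text \<open>9/20 = 1/5 + 1/4. Rows at level 0 have weight above 5 out of a total of at most
  \<open>card J\<close>; tight rows at intermediate levels take 8 each out of
  \<open>2 * card J\<close>; at level \<open>K\<close> the monitored row is zero.\<close>

lemma tight_rows_le:
  assumes x: "\<And>j. \<bar>x $ j\<bar> \<le> 1" and pot: "pot J b x \<le> real CARD('n) * exp (3 * D ^ 4) + (norm x)\<^sup>2"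
  shows "card {i. sub i (level J i) \<noteq> 0 \<and> \<bar>sub i (level J i) \<bullet> x - b i\<bar> = width (level J i)}
    \<le> 9 / 20 * real (card J)"
proof -
  define B0 where "B0 = {i. level J i = 0}"
  define B1 where "B1 = {i. 0 < level J i \<and> level J i < K \<and>
      \<bar>sub i (level J i) \<bullet> x - b i\<bar> = width (level J i)}"
  have sub: "{i. sub i (level J i) \<noteq> 0 \<and> \<bar>sub i (level J i) \<bullet> x - b i\<bar> = width (level J i)} \<subseteq> B0 \<union> B1"
  proof
    fix i assume "i \<in> {i. sub i (level J i) \<noteq> 0 \<and> \<bar>sub i (level J i) \<bullet> x - b i\<bar> = width (level J i)}"
    then show "i \<in> B0 \<union> B1" using level_le_K[of J i] sub_K[of i]
      unfolding B0_def B1_def by (cases "level J i = K") auto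
  qed
  have "5 * real (card B0) = (\<Sum>i\<in>B0. 5)" by simp
  also have "\<dots> \<le> (\<Sum>i\<in>B0. weight i 0 J)"
  proof (rule sum_mono)
    show "5 \<le> weight i 0 J" if "i \<in> B0" for i
      using weight_gt_at_level[of J i] K_pos that by (simp add: B0_def)
  qed
  also have "\<dots> \<le> (\<Sum>i\<in>UNIV. weight i 0 J)"
    by (intro sum_mono2) (auto simp: weight_def sum_nonneg)
  also have "\<dots> = (\<Sum>j\<in>J. \<Sum>i\<in>UNIV. (A $ i $ j)\<^sup>2)"
    unfolding weight_def sub_0 by (rule sum.swap)
  also have "\<dots> \<le> (\<Sum>j\<in>J. 1)" by (intro sum_mono column_norm)
  finally have 0: "5 * real (card B0) \<le> card J" by simp
  have "8 * real (card B1) = (\<Sum>i\<in>B1. 8)" by simp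
  also have "\<dots> \<le> (\<Sum>i\<in>B1. weight i (level J i) J * rowpot J b i x)"
    by (intro sum_mono tight_row_ge x) (auto simp: B1_def)
  also have "\<dots> \<le> (\<Sum>i\<in>UNIV. weight i (level J i) J * rowpot J b i x)"
    using rowpot_pos by (intro sum_mono2) (auto simp: weight_def sum_nonneg less_imp_le)
  also have "\<dots> \<le> 2 * card J" by (intro sum_weight_rowpot_le x pot)
  finally have 1: "8 * real (card B1) \<le> 2 * card J" by simp
  have "card {i. sub i (level J i) \<noteq> 0 \<and> \<bar>sub i (level J i) \<bullet> x - b i\<bar> = width (level J i)} \<le> card B0 + card B1"
    using card_mono[OF _ sub] card_Un_le[of B0 B1] by (meson finite le_trans)
  then show ?thesis using 0 1 by linarith
qed

text \<open>Rows are controlled against every completion of the frozen part, since entries that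
  have left \<^term>\<open>sub i (level J i)\<close> are no longer monitored.\<close>

definition invariant :: "'n set \<Rightarrow> ('m \<Rightarrow> real) \<Rightarrow> real ^ 'n \<Rightarrow> bool" where
  "invariant J b x \<longleftrightarrow> (\<forall>j. \<bar>x $ j\<bar> \<le> 1) \<and> (\<forall>j. j \<notin> J \<longrightarrow> \<bar>x $ j\<bar> = 1) \<and>
    (\<forall>i. \<bar>sub i (level J i) \<bullet> x - b i\<bar> \<le> width (level J i)) \<and>
    pot J b x \<le> real CARD('n) * exp (3 * D ^ 4) + (norm x)\<^sup>2 \<and>
    (\<forall>i x'. (\<forall>j. \<bar>x' $ j\<bar> \<le> 1) \<longrightarrow> (\<forall>j. j \<notin> J \<longrightarrow> x' $ j = x $ j) \<longrightarrow>
      \<bar>b i + (A $ i - sub i (level J i)) \<bullet> x'\<bar> \<le> slack (level J i))"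

section \<open>Maintaining the invariant\<close>

lemma invariant_init: "invariant UNIV (\<lambda>i. 0) 0"
  unfolding invariant_def
proof (intro conjI allI impI)
  show "pot UNIV (\<lambda>i. 0) 0 \<le> real CARD('n) * exp (3 * D ^ 4) + (norm (0 :: real ^ 'n))\<^sup>2"
  proof -
    \<comment> \<open>With anchors 0 at the origin every row is fresh, so its potential is at most
      \<open>base 0 = 1\<close> and each load at most the squared column norm.\<close>
    have "colload UNIV (\<lambda>i. 0) j 0 \<le> 1" for j
    proof -
      have "rowpot UNIV (\<lambda>i. 0) i 0 \<le> 1" for i
        using fresh_rowpot_le[of 0 UNIV "\<lambda>i. 0" i] base_antimono[of 0 "level UNIV i - 1"] base_0 by simp
      then have "colload UNIV (\<lambda>i. 0) j 0 \<le> (\<Sum>i\<in>UNIV. (A $ i $ j)\<^sup>2 * 1)"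
        unfolding colload_def using sub_sq_antimono[of 0 "level UNIV _" _ j] rowpot_pos
        by (intro sum_mono mult_mono) (auto simp: sub_0 less_imp_le)
      also have "\<dots> \<le> 1" using column_norm by simp
      finally show ?thesis .
    qed
    then have "pot UNIV (\<lambda>i. 0) 0 \<le> (\<Sum>j\<in>(UNIV :: 'n set). exp (3 * D ^ 4))"
      unfolding pot_def using D_ge_1 by (intro sum_mono) (simp add: mult_left_le)
    then show ?thesis by simp
  qed
  fix i and x' :: "real ^ 'n"
  assume x': "\<forall>j. \<bar>x' $ j\<bar> \<le> 1"
  let ?k = "level UNIV i"
  have "\<bar>(A $ i - sub i ?k) \<bullet> x'\<bar> \<le> (\<Sum>j\<in>UNIV. \<bar>sub i 0 $ j - sub i ?k $ j\<bar> * \<bar>x' $ j\<bar>)"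
    unfolding inner_vec_def by (rule order_trans[OF sum_abs]) (simp add: abs_mult sub_0)
  also have "\<dots> \<le> (\<Sum>j\<in>UNIV. \<bar>sub i 0 $ j - sub i ?k $ j\<bar>)"
    using x' by (intro sum_mono) (simp add: mult_left_le)
  also have "\<dots> \<le> (\<Sum>l\<in>{0..<?k}. 25 * D / 2 ^ l)"
    by (intro sub_band_le weight_le_below_level) auto
  also have "\<dots> \<le> slack ?k"
    unfolding slack_def lessThan_atLeast0 using D_ge_1 width_nonneg
    by (intro sum_mono) (auto intro!: add_increasing divide_right_mono)
  finally show "\<bar>0 + (A $ i - sub i ?k) \<bullet> x'\<bar> \<le> slack ?k" by simp
qed (auto simp: width_nonneg)

text \<open>A row whose level rises is anchored anew at its present value. Its potential does not
  grow: a fresh row at level k' costs at most \<open>base (k' - 1)\<close>, hence at most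
  \<open>base\<close> at the old level, hence at most its old potential.\<close>

lemma invariant_freeze:
  assumes inv: "invariant J b x" and "J' \<subseteq> J" and off: "\<And>j. j \<notin> J' \<Longrightarrow> \<bar>x $ j\<bar> = 1"
  obtains b' where "invariant J' b' x"
proof -
  define b' where "b' i = (if level J' i = level J i then b i else sub i (level J' i) \<bullet> x)" for i
  have lev: "level J i \<le> level J' i" for i by (rule level_mono) fact
  have x: "\<And>j. \<bar>x $ j\<bar> \<le> 1"
    and wd: "\<And>i. \<bar>sub i (level J i) \<bullet> x - b i\<bar> \<le> width (level J i)"
    and pot: "pot J b x \<le> real CARD('n) * exp (3 * D ^ 4) + (norm x)\<^sup>2"
    and sl: "\<And>i x'. (\<And>j. \<bar>x' $ j\<bar> \<le> 1) \<Longrightarrow> (\<And>j. j \<notin> J \<Longrightarrow> x' $ j = x $ j) \<Longrightarrow>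
      \<bar>b i + (A $ i - sub i (level J i)) \<bullet> x'\<bar> \<le> slack (level J i)"
    using inv unfolding invariant_def by blast+
  have row: "rowpot J' b' i x \<le> rowpot J b i x" for i
  proof (cases "level J' i = level J i")
    case True
    then show ?thesis by (simp add: rowpot_def b'_def)
  next
    case False
    then have "rowpot J' b' i x \<le> base (level J' i - 1)"
      by (intro fresh_rowpot_le x off) (auto simp: b'_def)
    also have "\<dots> \<le> base (level J i)" using False lev[of i] by (intro base_antimono) auto
    also have "\<dots> \<le> base (level J i) * cosh (rate (level J i) * (sub i (level J i) \<bullet> x - b i))"
      using mult_left_mono[OF cosh_real_ge_1 less_imp_le[OF base_pos]] by simp
    also have "\<dots> \<le> rowpot J b i x" by (rule base_le_rowpot[OF x])
    finally show ?thesis .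
  qed
  have "colload J' b' j x \<le> colload J b j x" for j
    unfolding colload_def using row lev rowpot_pos
    by (intro sum_mono mult_mono sub_sq_antimono) (auto simp: less_imp_le)
  then have "pot J' b' x \<le> (\<Sum>j\<in>J'. exp (3 * D ^ 4 * colload J b j x))"
    unfolding pot_def using D_ge_1 by (intro sum_mono) (simp add: mult_left_mono)
  also have "\<dots> \<le> pot J b x"
    unfolding pot_def using \<open>J' \<subseteq> J\<close> by (intro sum_mono2) auto
  also note pot
  finally have pot': "pot J' b' x \<le> real CARD('n) * exp (3 * D ^ 4) + (norm x)\<^sup>2" .
  have sl': "\<bar>b' i + (A $ i - sub i (level J' i)) \<bullet> x'\<bar> \<le> slack (level J' i)"
    if x': "\<And>j. \<bar>x' $ j\<bar> \<le> 1" "\<And>j. j \<notin> J' \<Longrightarrow> x' $ j = x $ j" for i x'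
  proof (cases "level J' i = level J i")
    case True
    then show ?thesis using sl[of x' i] x' \<open>J' \<subseteq> J\<close> by (auto simp: b'_def)
  next
    case False
    define k k' where "k = level J i" and "k' = level J' i"
    have "k < k'" using False lev[of i] by (simp add: k_def k'_def)
    \<comment> \<open>The three terms are the old guarantee, the old deviation, and the newly
      dropped entries tested against \<open>x' - x\<close>, which vanishes off
      \<open>J'\<close>.\<close>
    have "b' i + (A $ i - sub i k') \<bullet> x' = (b i + (A $ i - sub i k) \<bullet> x') + (sub i k \<bullet> x - b i)
        + (sub i k - sub i k') \<bullet> (x' - x)"
      using False by (simp add: b'_def k_def k'_def inner_diff_left inner_diff_right)
    moreover have "\<bar>b i + (A $ i - sub i k) \<bullet> x'\<bar> \<le> slack k"
      unfolding k_def using x' \<open>J' \<subseteq> J\<close> by (intro sl) auto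
    moreover have "\<bar>sub i k \<bullet> x - b i\<bar> \<le> width k" using wd by (simp add: k_def)
    moreover have "\<bar>(sub i k - sub i k') \<bullet> (x' - x)\<bar> \<le> (\<Sum>l\<in>{k..<k'}. 50 * D / 2 ^ l)"
    proof -
      have "\<bar>(sub i k - sub i k') \<bullet> (x' - x)\<bar> \<le> (\<Sum>j\<in>UNIV. \<bar>sub i k $ j - sub i k' $ j\<bar> * \<bar>x' $ j - x $ j\<bar>)"
        unfolding inner_vec_def by (rule order_trans[OF sum_abs]) (simp add: abs_mult)
      also have "\<dots> = (\<Sum>j\<in>J'. \<bar>sub i k $ j - sub i k' $ j\<bar> * \<bar>x' $ j - x $ j\<bar>)"
        using x'(2) by (intro sum.mono_neutral_right) auto
      also have "\<dots> \<le> (\<Sum>j\<in>J'. \<bar>sub i k $ j - sub i k' $ j\<bar> * 2)"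
      proof (intro sum_mono mult_left_mono)
        show "\<bar>x' $ j - x $ j\<bar> \<le> 2" for j using x'(1)[of j] x[of j] by linarith
      qed auto
      also have "\<dots> = (\<Sum>j\<in>J'. \<bar>sub i k $ j - sub i k' $ j\<bar>) * 2" by (simp add: sum_distrib_right)
      also have "\<dots> \<le> (\<Sum>l\<in>{k..<k'}. 25 * D / 2 ^ l) * 2"
        using \<open>k < k'\<close> by (intro mult_right_mono sub_band_le) (auto simp: k'_def weight_le_below_level)
      also have "\<dots> = (\<Sum>l\<in>{k..<k'}. 50 * D / 2 ^ l)" by (simp add: sum_distrib_right)
      finally show ?thesis .
    qed
    moreover have "slack k + width k + (\<Sum>l\<in>{k..<k'}. 50 * D / 2 ^ l) \<le> slack k'"
    proof -
      have "width k \<le> (\<Sum>l\<in>{k..<k'}. width l)"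
        using \<open>k < k'\<close> width_nonneg by (intro member_le_sum) auto
      moreover have "slack k' = slack k + (\<Sum>l\<in>{k..<k'}. width l + 50 * D / 2 ^ l)"
        unfolding slack_def lessThan_atLeast0
        using \<open>k < k'\<close> by (intro sum.atLeastLessThan_concat[symmetric]) auto
      ultimately show ?thesis by (simp add: sum.distrib)
    qed
    ultimately have "\<bar>b' i + (A $ i - sub i k') \<bullet> x'\<bar> \<le> slack k'" by linarith
    then show ?thesis by (simp add: k'_def)
  qed
  have "\<bar>sub i (level J' i) \<bullet> x - b' i\<bar> \<le> width (level J' i)" for i
    using wd[of i] width_nonneg by (simp add: b'_def)
  then have "invariant J' b' x"
    unfolding invariant_def using x off pot' sl' by blast
  then show ?thesis by (rule that)
qed

text \<open>The freezing step brings some live coordinate to modulus 1; all such coordinates then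
  leave the live set together.\<close>

lemma invariant_step:
  assumes inv: "invariant J b x0" and "J \<noteq> {}"
  obtains J' b' x where "J' \<subset> J" "invariant J' b' x"
proof -
  interpret column_potential "\<lambda>i. sub i (level J i)" "\<lambda>i. base (level J i)" "\<lambda>i. rate (level J i)"
    "\<lambda>i. decay (level J i)" b "3 * D ^ 4" "1 / (4 * D\<^sup>2)" "8 / 125 / D\<^sup>2" "1 / 4" J
    by (rule level_potential)
  have G: "G i x = rowpot J b i x" for i x by (simp add: G_def rowpot_def)
  have \<Phi>: "\<Phi> x = pot J b x" for x by (simp add: \<Phi>_def pot_def load_def colload_def G)
  obtain x where x: "(\<forall>j. \<bar>x $ j\<bar> \<le> 1) \<and> (\<forall>j. j \<notin> J \<longrightarrow> x $ j = x0 $ j) \<and>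
      (\<forall>i. \<bar>sub i (level J i) \<bullet> x - b i\<bar> \<le> width (level J i))"
    and pot: "\<Phi> x \<le> real CARD('n) * exp (3 * D ^ 4) + (norm x)\<^sup>2" and hit: "\<exists>j\<in>J. \<bar>x $ j\<bar> = 1"
  proof (rule freezing_step[of x0 "\<lambda>i. width (level J i)" "real CARD('n) * exp (3 * D ^ 4)" "cutoff_sq J"])
    fix x
    assume f: "(\<forall>j. \<bar>x $ j\<bar> \<le> 1) \<and> (\<forall>j. j \<notin> J \<longrightarrow> x $ j = x0 $ j) \<and>
      (\<forall>i. \<bar>sub i (level J i) \<bullet> x - b i\<bar> \<le> width (level J i))"
      and p: "\<Phi> x \<le> real CARD('n) * exp (3 * D ^ 4) + (norm x)\<^sup>2"
    show "(\<Sum>i\<in>UNIV. if decay (level J i) = 0 then 0 else cutoff_sq J i * G i x) \<le> 8 / 125 / D\<^sup>2 * card J"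
      unfolding G using f p by (intro trace_le) (auto simp: \<Phi>)
    have "card J > 0" using \<open>J \<noteq> {}\<close> by (simp add: card_gt_0_iff)
    \<comment> \<open>Blocked rows take a share 9/20 and the two exceptional sets 1/4 each, 19/20 in
      total.\<close>
    then show "real (card {i. sub i (level J i) \<noteq> 0 \<and> \<bar>sub i (level J i) \<bullet> x - b i\<bar> = width (level J i)})
        + 2 * (1 / 4) * card J < card J"
      using tight_rows_le[of x J b] f p by (simp add: \<Phi>)
  qed (use inv \<open>J \<noteq> {}\<close> in \<open>auto simp: invariant_def \<Phi> sub_sq_le_cutoff_sq\<close>)
  define J' where "J' = {j \<in> J. \<bar>x $ j\<bar> \<noteq> 1}"
  have "invariant J b x"
    unfolding invariant_def
  proof (intro conjI allI impI)
    show "\<bar>x $ j\<bar> = 1" if "j \<notin> J" for j using x inv that by (auto simp: invariant_def)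
    show "\<bar>b i + (A $ i - sub i (level J i)) \<bullet> x'\<bar> \<le> slack (level J i)"
      if "\<forall>j. \<bar>x' $ j\<bar> \<le> 1" "\<forall>j. j \<notin> J \<longrightarrow> x' $ j = x $ j" for i x'
      using inv x that unfolding invariant_def by simp
  qed (use x pot in \<open>auto simp: \<Phi>\<close>)
  moreover have "J' \<subset> J" using hit by (auto simp: J'_def)
  moreover have "\<bar>x $ j\<bar> = 1" if "j \<notin> J'" for j
    using that \<open>invariant J b x\<close> by (cases "j \<in> J") (auto simp: J'_def invariant_def)
  ultimately show ?thesis using invariant_freeze[of J b x J'] that by blast
qed

text \<open>Strictly shrinking live sets end at the empty one. There \<open>x\<close> is its only
  completion, so monitored and dropped parts add up to the full row, bounded by slack plus
  width.\<close>

lemma exists_good_signs: "\<exists>\<sigma>\<in>sign_vectors. \<forall>i. \<bar>A $ i \<bullet> \<sigma>\<bar> \<le> 820 * D"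
proof -
  have "\<exists>b x. invariant {} b x" if "invariant J b x" for J b x
    using that
  proof (induction "card J" arbitrary: J b x rule: less_induct)
    case less
    show ?case
    proof (cases "J = {}")
      case False
      obtain J' b' x' where "J' \<subset> J" "invariant J' b' x'"
        using invariant_step[OF less.prems False] .
      then show ?thesis using less.hyps[of J'] by (simp add: psubset_card_mono)
    qed (use less.prems in blast)
  qed
  then obtain b x where inv: "invariant {} b x" using invariant_init by blast
  have "x \<in> sign_vectors"
    using inv by (auto simp: invariant_def sign_vectors_def abs_if split: if_splits)
  moreover have "\<bar>A $ i \<bullet> x\<bar> \<le> 820 * D" for i
  proof -
    let ?k = "level {} i"
    have "\<bar>b i + (A $ i - sub i ?k) \<bullet> x\<bar> \<le> slack ?k" "\<bar>sub i ?k \<bullet> x - b i\<bar> \<le> width ?k"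
      using inv by (auto simp: invariant_def)
    then show ?thesis using slack_width_le[of ?k] by (simp add: inner_diff_left)
  qed
  ultimately show ?thesis by blast
qed

end

section \<open>Choice of parameters and the final bound\<close>

lemma large_cutoff_index:
  fixes A :: "real ^ 'n::finite ^ 'm::finite"
  assumes "c > 0"
  obtains K :: nat where "K > 0" "\<And>i j. A $ i $ j \<noteq> 0 \<Longrightarrow> \<bar>A $ i $ j\<bar> > c / 2 ^ K"
proof -
  have "(\<lambda>K. c * (1/2) ^ K) \<longlonglongrightarrow> c * 0"
    by (intro tendsto_mult tendsto_const LIMSEQ_power_zero) auto
  then have "(\<lambda>K. c / 2 ^ K) \<longlonglongrightarrow> 0" by (simp add: power_divide)
  then have "\<forall>\<^sub>F K in sequentially. c / 2 ^ K < \<bar>A $ i $ j\<bar>" if "A $ i $ j \<noteq> 0" for i j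
    by (rule order_tendstoD) (use that in simp)
  then have "\<forall>\<^sub>F K in sequentially. \<forall>i j. A $ i $ j \<noteq> 0 \<longrightarrow> c / 2 ^ K < \<bar>A $ i $ j\<bar>"
    by (intro eventually_all_finite) (auto intro: eventually_mono)
  \<comment> \<open>Positivity is added because level 0 applies no cut, whereas the monitored part
    has to vanish at level \<open>K\<close>.\<close>
  then have "\<forall>\<^sub>F K in sequentially. K > 0 \<and> (\<forall>i j. A $ i $ j \<noteq> 0 \<longrightarrow> c / 2 ^ K < \<bar>A $ i $ j\<bar>)"
    using eventually_gt_at_top[of 0] by eventually_elim auto
  then show ?thesis using that by (auto simp: eventually_sequentially)
qed

theorem theorem1p1:
  fixes A :: "real ^ 'n ^ 'm"
  assumes "\<And>j. (\<Sum>i\<in>UNIV. (A $ i $ j)\<^sup>2) \<le> 1"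
  shows "disc A \<le> 2395 * (1 + log_plus (real CARD('n) / 9)) powr (1 / 4) + 2 * sqrt 2"
proof -
  define L where "L = 1 + log_plus (real CARD('n) / 9)"
  have L: "L \<ge> 1" by (simp add: L_def log_plus_def)
  define D where "D = L powr (1 / 4)"
  have D: "D \<ge> 1" using L by (simp add: D_def ge_one_powr_ge_zero)
  have "D ^ 4 = D powr 4" using D by (simp add: powr_realpow)
  then have D4: "D ^ 4 = L" using L by (simp add: D_def powr_powr)
  \<comment> \<open>Splitting off n/9 matches \<open>L\<close>: with ln 18 \<le> 3 the sum is at
    most 3 + (L - 1) \<le> 3 L, as L \<ge> 1.\<close>
  have "ln (2 * real CARD('n)) = ln 18 + ln (real CARD('n) / 9)"
    using ln_mult[of 18 "real CARD('n) / 9"] by simp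
  also have "ln (real CARD('n) / 9) \<le> L - 1" by (simp add: L_def log_plus_def)
  also have "ln 18 \<le> (3::real)"
  proof -
    \<comment> \<open>The quadratic Taylor bound at 1/2 is 1 + 1/2 + 1/8 = 13/8, and its sixth power
      exceeds 18.\<close>
    have "13/8 \<le> exp (1/2 :: real)"
      using exp_lower_Taylor_quadratic[of "1/2 :: real"] by (simp add: power2_eq_square)
    then have "(13/8) ^ 6 \<le> exp (1/2 :: real) ^ 6" by (intro power_mono) auto
    also have "exp (1/2 :: real) ^ 6 = exp 3" by (simp flip: exp_of_nat_mult)
    finally have "18 \<le> exp (3 :: real)" by (simp add: power_divide)
    then have "ln 18 \<le> ln (exp (3 :: real))" by (intro ln_mono) auto
    then show ?thesis by simp
  qed
  also have "3 + (L - 1) \<le> 3 * D ^ 4" using L by (simp add: D4)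
  finally have log: "ln (2 * real CARD('n)) \<le> 3 * D ^ 4" by simp
  obtain K where "K > 0" "\<And>i j. A $ i $ j \<noteq> 0 \<Longrightarrow> \<bar>A $ i $ j\<bar> > 2 / 5 / D / 2 ^ K"
    using large_cutoff_index[of "2 / 5 / D" A] D by auto
  then interpret komlos A D K
    using assms D log by unfold_locales (auto simp: field_simps)
  obtain \<sigma> where \<sigma>: "\<sigma> \<in> sign_vectors" "\<And>i. \<bar>A $ i \<bullet> \<sigma>\<bar> \<le> 820 * D"
    using exists_good_signs by blast
  have "disc A \<le> infnorm (A *v \<sigma>)"
    unfolding disc_def using \<sigma>(1) by (intro Min_le finite_imageI finite_sign_vectors) auto
  also have "\<dots> \<le> 820 * D"
    unfolding infnorm_cart using \<sigma>(2)
    by (intro cSup_least) (auto simp: matrix_vector_mul_component)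
  also have "\<dots> \<le> 2395 * D + 2 * sqrt 2" using D by simp
  finally show ?thesis by (simp add: D_def L_def)
qed

end
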